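(* If $F$ is a forest, then $\mathcal{M}(F)$ is finite if and only if $F=tK_2$ (a matching with $t$ edges) for some $t$.
   Context: For a graph $G$, let $F_{G,1}$ be the set of maps $f:E(G)\to E(G)$ with $f(e)\neq e$ for all $e$. A subgraph $G'$ of $G$ is $f$-free if $f(e)\notin E(G')$ for all $e\in E(G')$. A graph $G$ is unavoidable for $H$ if for every $f\in F_{G,1}$ there exists an $f$-free copy of $H$ in $G$. $\mathcal{M}(H)$ is the set (up to isomorphism) of minimal unavoidable graphs for $H$, i.e. unavoidable graphs none of whose proper subgraphs is unavoidable.
   Formalization: F is assumed to have no isolated vertices (for K_2+K_1 the claim fails), and an unavoidable graph G must also contain a copy of H (otherwise K_2, for which F_{G,1} is empty, is vacuously unavoidable for every H and every M(H) with H having an edge is {K_2}). *)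

theory Defs
  imports Main "HOL-Library.FuncSet"
begin

type_synonym 'a graph = "'a set \<times> 'a set set"

abbreviation verts :: "'a graph \<Rightarrow> 'a set" where
  "verts G \<equiv> fst G"

abbreviation edges :: "'a graph \<Rightarrow> 'a set set" where
  "edges G \<equiv> snd G"

definition fin_simple_graph :: "'a graph \<Rightarrow> bool" where
  "fin_simple_graph G \<longleftrightarrow> finite (verts G) \<and> (\<forall>e\<in>edges G. e \<subseteq> verts G \<and> card e = 2)"

definition subgraph :: "'a graph \<Rightarrow> 'a graph \<Rightarrow> bool" where
  "subgraph G' G \<longleftrightarrow> fin_simple_graph G' \<and> fin_simple_graph G \<and>
     verts G' \<subseteq> verts G \<and> edges G' \<subseteq> edges G"

definition graph_iso :: "'a graph \<Rightarrow> 'b graph \<Rightarrow> bool" where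
  "graph_iso G H \<longleftrightarrow> fin_simple_graph G \<and> fin_simple_graph H \<and>
     (\<exists>\<phi>. bij_betw \<phi> (verts G) (verts H) \<and> (image \<phi>) ` edges G = edges H)"

definition is_cycle :: "'a graph \<Rightarrow> 'a list \<Rightarrow> bool" where
  "is_cycle G vs \<longleftrightarrow> 3 \<le> length vs \<and> distinct vs \<and>
     (\<forall>i<length vs. {vs ! i, vs ! (Suc i mod length vs)} \<in> edges G)"

definition forest :: "'a graph \<Rightarrow> bool" where
  "forest G \<longleftrightarrow> fin_simple_graph G \<and> (\<nexists>vs. is_cycle G vs)"

text \<open>
  The convention that the target graph \<open>H\<close> has no isolated vertices is needed: for \<open>H = K\<^sub>2 + K\<^sub>1\<close> every
  graph with at least two edges is unavoidable, so there are only finitely many minimal ones.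
\<close>

definition no_isolated_verts :: "'a graph \<Rightarrow> bool" where
  "no_isolated_verts G \<longleftrightarrow> (\<forall>v\<in>verts G. \<exists>e\<in>edges G. v \<in> e)"

definition tK2 :: "nat \<Rightarrow> nat graph" where
  "tK2 t = ({..<2 * t}, (\<lambda>i. {2 * i, 2 * i + 1}) ` {..<t})"

text \<open>The set \<open>F\<^sub>G\<^sub>,\<^sub>1\<close> of maps without fixed edges.\<close>

definition edge_maps :: "'a graph \<Rightarrow> ('a set \<Rightarrow> 'a set) set" where
  "edge_maps G = {f \<in> edges G \<rightarrow>\<^sub>E edges G. \<forall>e\<in>edges G. f e \<noteq> e}"

definition free_subgraph :: "('a set \<Rightarrow> 'a set) \<Rightarrow> 'a graph \<Rightarrow> bool" where
  "free_subgraph f G' \<longleftrightarrow> (\<forall>e\<in>edges G'. f e \<notin> edges G')"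

definition copy_in :: "'b graph \<Rightarrow> 'a graph \<Rightarrow> 'a graph \<Rightarrow> bool" where
  "copy_in H G G' \<longleftrightarrow> subgraph G' G \<and> graph_iso H G'"

text \<open>
  If \<open>G\<close> has exactly one edge, then \<open>edge_maps G\<close> is empty, and the quantification over it alone
  would make \<open>G\<close> vacuously unavoidable for every graph. The first existential excludes this: an
  unavoidable graph has to contain a copy of \<open>H\<close>. Whenever \<open>edge_maps G\<close> is nonempty, i.e. whenever
  \<open>G\<close> does not have exactly one edge, it is implied by the second conjunct.
\<close>

definition unavoidable :: "'b graph \<Rightarrow> 'a graph \<Rightarrow> bool" where
  "unavoidable H G \<longleftrightarrow>
     (\<exists>G'. copy_in H G G') \<and>
     (\<forall>f\<in>edge_maps G. \<exists>G'. copy_in H G G' \<and> free_subgraph f G')"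

definition minimal_unavoidable :: "'b graph \<Rightarrow> 'a graph \<Rightarrow> bool" where
  "minimal_unavoidable H G \<longleftrightarrow> unavoidable H G \<and>
     (\<forall>G'. subgraph G' G \<and> G' \<noteq> G \<longrightarrow> \<not> unavoidable H G')"

text \<open>
  The set \<open>\<M>(H)\<close> of isomorphism classes; every finite graph is isomorphic to one whose vertices are
  natural numbers.
\<close>

definition min_unavoidables :: "'b graph \<Rightarrow> nat graph set set" where
  "min_unavoidables H = {G. minimal_unavoidable H G} // {(G, G'). graph_iso G G'}"

end

theory Submission
  imports Defs "HOL-Library.Disjoint_Sets" "HOL-Library.Nat_Bijection"
begin

text \<open>
  A map \<open>f\<close> on the edges is a digraph of outdegree one on them, so every set of edges contains an
  \<open>f\<close>-free third. Hence \<open>3tK\<^sub>2\<close> is unavoidable for \<open>tK\<^sub>2\<close>, which bounds the matching number of a minimal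
  unavoidable graph for \<open>tK\<^sub>2\<close>; an exchange argument bounds its degrees.

  For every other forest there are unavoidable graphs in which all small subgraphs are avoidable.
  If some edge of \<open>F\<close> has two endpoints of degree at least 2, then no forest is unavoidable
  (map each edge to its parent edge), while any graph of large average degree is, because an \<open>f\<close>-free third of its
  edges still contains \<open>F\<close>; so take such a graph of large girth. Otherwise \<open>F\<close> is a disjoint union of
  stars, the largest having \<open>k\<close> edges. By Turan, spoiling all \<open>f\<close>-free \<open>k\<close>-stars at a vertex of degree
  \<open>3k - 3\<close> or \<open>3k - 4\<close> requires \<open>f\<close> to map \<open>3k - 3\<close> or \<open>3k - 5\<close> edges at this vertex to edges at it. A long caterpillar
  with spine ends of the former and inner spine vertices of the latter degree has one edge too few for this,
  but any missing spine edge makes up for it. Many disjoint copies of it are unavoidable for \<open>F\<close>.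
\<close>

section \<open>Independent sets of sparse digraphs\<close>

text \<open>Large girth cannot settle star forests: a star with \<open>3 * k\<close> edges is a
  tree, yet an \<open>f\<close>-free third of it is a star with \<open>k\<close> edges. The parent
  map is of no use there either, as sibling edges are not mapped to each other; it only hits paths
  of three edges. So the star case needs an exact count. Call \<open>e\<close> an arc at
  \<open>v\<close> if \<open>e\<close> and \<open>f e\<close> both contain \<open>v\<close>.
  Distinct edges share at most one vertex, so each edge is an arc at no more than one vertex, and
  the arcs number at most the edges. With \<open>k = m + 2\<close> and a spine of \<open>n\<close>
  edges, spoiling all spine vertices takes \<open>2 * (3 * m + 3) + (n - 1) * (3 * m + 1)\<close>
  arcs, whereas the caterpillar has \<open>n * (3 * m + 1) + 3 * m + 4\<close> edges, one fewer.
  Losing a spine edge lowers Turan's requirement by 2 at each of its ends, but the supply only by 1.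
  Many copies are taken because \<open>F\<close> may have several components and \<open>f\<close>
  may map between caterpillars.\<close>

lemma independent_subset:
  assumes "finite A" and "\<And>x. x \<in> A \<Longrightarrow> card (N x \<inter> A) \<le> k" and "t * (2 * k + 1) \<le> card A"
  shows "\<exists>I\<subseteq>A. card I = t \<and> (\<forall>x\<in>I. \<forall>y\<in>I. y \<in> N x \<longrightarrow> y = x)"
  using assms
proof (induction t arbitrary: A)
  case 0
  show ?case by (rule exI[of _ "{}"]) simp
next
  case (Suc t)
  let ?B = "\<lambda>x. {y \<in> A. x \<in> N y}"
  \<comment> \<open>Indegrees and outdegrees have the same sum, so some indegree is at most
    \<open>k\<close>. Selecting that \<open>x\<close> and discarding it with its out- and
    in-neighbours costs at most \<open>2 * k + 1\<close> elements, the factor in the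
    hypothesis.\<close>
  have "\<exists>x\<in>A. card (?B x) \<le> k"
  proof (rule ccontr)
    assume "\<not> ?thesis"
    then have *: "\<And>x. x \<in> A \<Longrightarrow> Suc k \<le> card (?B x)" by force
    have "Suc k * card A \<le> (\<Sum>x\<in>A. card (?B x))"
      using sum_mono[of A "\<lambda>_. Suc k", OF *] by (simp add: mult.commute)
    also have "\<dots> = (\<Sum>x\<in>A. \<Sum>y\<in>A. if x \<in> N y then 1 else 0)"
      using Suc.prems(1) by (simp add: sum.If_cases Int_def)
    also have "\<dots> = (\<Sum>y\<in>A. \<Sum>x\<in>A. if x \<in> N y then 1 else 0)" by (rule sum.swap)
    also have "\<dots> = (\<Sum>y\<in>A. card (N y \<inter> A))"
      using Suc.prems(1) by (simp add: sum.If_cases Int_commute)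
    also have "\<dots> \<le> k * card A"
      using sum_mono[of A "\<lambda>y. card (N y \<inter> A)" "\<lambda>_. k"] Suc.prems(2) by (simp add: mult.commute)
    finally have "card A = 0" by simp
    then show False using Suc.prems(3) by simp
  qed
  then obtain x where x: "x \<in> A" "card (?B x) \<le> k" by blast
  define D where "D = insert x ((N x \<inter> A) \<union> ?B x)"
  have fD: "finite D" "D \<subseteq> A" using Suc.prems(1) x by (auto simp: D_def)
  have "card D \<le> Suc (card (N x \<inter> A) + card (?B x))"
    unfolding D_def using card_Un_le[of "N x \<inter> A" "?B x"] Suc.prems(1) by (simp add: card_insert_if)
  then have "card D \<le> 2 * k + 1" using x Suc.prems(2)[OF x(1)] by simp
  then have "t * (2 * k + 1) \<le> card (A - D)"
    using Suc.prems(3) card_Diff_subset[OF fD] by simp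
  moreover have "card (N y \<inter> (A - D)) \<le> k" if "y \<in> A - D" for y
    using that Suc.prems(1) by (intro order_trans[OF card_mono Suc.prems(2)[of y]]) auto
  ultimately obtain I where I: "I \<subseteq> A - D" "card I = t" "\<forall>x\<in>I. \<forall>y\<in>I. y \<in> N x \<longrightarrow> y = x"
    using Suc.IH[of "A - D"] Suc.prems(1) by blast
  have "finite I" "x \<notin> I" using I(1) Suc.prems(1) finite_subset by (auto simp: D_def)
  moreover have "\<forall>y\<in>I. y \<notin> N x \<and> x \<notin> N y" using I(1) by (auto simp: D_def)
  ultimately show ?case using I x(1) by (intro exI[of _ "insert x I"]) auto
qed

text \<open>Turan's bound for graphs whose edges come from a partial map; equality holds for disjoint
  triangles and edges.\<close>

lemma independent_subset_Turan:
  assumes "finite X" and "\<forall>x\<in>X. f x \<noteq> x"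
  shows "\<exists>I\<subseteq>X. (\<forall>x\<in>I. f x \<notin> I) \<and> 2 * card X \<le> 3 * card I + card {x \<in> X. f x \<in> X}"
  using assms
proof (induction "card X" arbitrary: X rule: less_induct)
  case less
  let ?a = "\<lambda>X. {x \<in> X. f x \<in> X}"
  \<comment> \<open>\<open>v\<close> joins the independent set, and \<open>D\<close>, which contains
    \<open>v\<close> and all its neighbours in \<open>X\<close>, is discarded. The new element
    contributes 3 on the right, so twice the size of \<open>D\<close> may exceed the number of lost
    arcs by 3.\<close>
  have step: ?case if D: "D \<subseteq> X" "v \<in> D" "f v \<notin> X - D" and pre: "\<And>x. x \<in> X \<Longrightarrow> f x = v \<Longrightarrow> x \<in> D"
    and bd: "2 * card D + card (?a (X - D)) \<le> 3 + card (?a X)" for v D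
  proof -
    have fD: "finite D" using D less.prems finite_subset by auto
    have card: "card X = card (X - D) + card D"
      using card_Diff_subset[OF fD D(1)] card_mono[OF less.prems(1) D(1)] by simp
    moreover have "card D \<noteq> 0" using D fD by auto
    ultimately obtain I where I: "I \<subseteq> X - D" "\<forall>x\<in>I. f x \<notin> I"
      "2 * card (X - D) \<le> 3 * card I + card (?a (X - D))"
      using less.hyps[of "X - D"] less.prems by fastforce
    have "v \<notin> I" "finite I" using I(1) D(2) less.prems(1) finite_subset by auto
    moreover have "f v \<noteq> v" using less.prems D by auto
    ultimately show ?thesis using I D pre bd card
      by (intro exI[of _ "insert v I"]) auto
  qed
  show ?case
  proof (cases "X \<subseteq> f ` X")
    case False
    then obtain v where v: "v \<in> X" "v \<notin> f ` X" by blast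
    show ?thesis
    proof (cases "f v \<in> X")
      case True
      \<comment> \<open>The arc of \<open>v\<close> itself is lost, which is enough:
        \<open>2 * 2 = 3 + 1\<close>.\<close>
      have "?a (X - {v, f v}) \<subseteq> ?a X - {v}" by auto
      from card_mono[OF _ this] have "card (?a (X - {v, f v})) \<le> card (?a X) - 1"
        using less.prems(1) v True by (simp add: card_Diff_singleton)
      moreover have "card (?a X) > 0" using True v less.prems(1) by (auto simp: card_gt_0_iff)
      moreover have "card {v, f v} = 2" using less.prems v by auto
      ultimately show ?thesis using v True by (intro step[of "{v, f v}" v]) auto
    next
      case False
      have "card (?a (X - {v})) \<le> card (?a X)" using less.prems(1) by (intro card_mono) auto
      then show ?thesis using v False by (intro step[of "{v}" v]) auto
    qed
  next
    case True
    then have eq: "f ` X = X"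
      using card_image_le[OF less.prems(1), of f] less.prems(1)
      by (metis card_seteq finite_imageI)
    then have inj: "inj_on f X" using less.prems(1) by (simp add: finite_surj_inj)
    show ?thesis
    proof (cases "X = {}")
      case False
      then obtain v where v: "v \<in> X" by blast
      then obtain u where u: "u \<in> X" "f u = v" using True by blast
      \<comment> \<open>Here \<open>f\<close> permutes \<open>X\<close>, so every element of
        \<open>X\<close> carries an arc and at least \<open>card ?D\<close> arcs are lost;
        \<open>card ?D \<le> 3\<close> then suffices. In a 2-cycle \<open>u\<close> and
        \<open>f v\<close> coincide.\<close>
      let ?D = "{v, u, f v}"
      have fv: "f v \<in> X" using eq v by blast
      then have D: "?D \<subseteq> X" using u v by auto
      have c: "card ?D \<le> 3" by (simp add: card_insert_if)
      have "card (?a (X - ?D)) \<le> card (X - ?D)" using less.prems(1) by (intro card_mono) auto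
      also have "\<dots> = card X - card ?D" by (rule card_Diff_subset[OF _ D]) simp
      finally have "card (?a (X - ?D)) + card ?D \<le> card X"
        using card_mono[OF less.prems(1) D] by simp
      moreover have "?a X = X" using eq by auto
      ultimately show ?thesis using c D u inj v
        by (intro step[of ?D v]) (auto dest: inj_onD)
    qed auto
  qed
qed

section \<open>Copies and unavoidable graphs\<close>

definition incident :: "'a set set \<Rightarrow> 'a \<Rightarrow> 'a set set" where
  "incident E v = {e \<in> E. v \<in> e}"

lemma finite_incident [simp]: "finite E \<Longrightarrow> finite (incident E v)"
  by (simp add: incident_def)

lemma fin_simple_graph_edgeD:
  assumes "fin_simple_graph G" "e \<in> edges G"
  shows "e \<subseteq> verts G" "card e = 2" "finite e"
  using assms by (auto simp: fin_simple_graph_def intro: card_ge_0_finite)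

lemma finite_edges: "fin_simple_graph G \<Longrightarrow> finite (edges G)"
  by (rule finite_subset[of _ "Pow (verts G)"]) (auto simp: fin_simple_graph_def)

lemma edge_other_endpoint:
  assumes "card e = 2" "v \<in> e"
  obtains u where "e = {v, u}" "u \<noteq> v"
  using assms by (auto simp: card_2_iff)

lemma edge_eqI: "card e = 2 \<Longrightarrow> card e' = 2 \<Longrightarrow> {v, w} \<subseteq> e \<Longrightarrow> {v, w} \<subseteq> e' \<Longrightarrow> v \<noteq> w \<Longrightarrow> e = e'"
  by (auto simp: card_2_iff)

lemma inj_on_image_edges:
  assumes "fin_simple_graph F" "inj_on \<phi> (verts F)"
  shows "inj_on ((`) \<phi>) (edges F)"
  using inj_on_image_Pow[OF assms(2)] fin_simple_graph_edgeD(1)[OF assms(1)]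
  by (meson PowI inj_on_subset subsetI)

lemma fin_simple_graph_image:
  assumes "fin_simple_graph F" "inj_on \<phi> (verts F)"
  shows "fin_simple_graph (\<phi> ` verts F, (`) \<phi> ` edges F)"
proof -
  have "card (\<phi> ` e) = 2" if "e \<in> edges F" for e
    using fin_simple_graph_edgeD(1,2)[OF assms(1) that] card_image inj_on_subset[OF assms(2)] by metis
  then show ?thesis using assms(1) by (auto simp: fin_simple_graph_def)
qed

text \<open>Every vertex of \<open>F\<close> lies on an edge, so controlling the images of the edges
  already places all vertices in \<open>G\<close>.\<close>

lemma copy_in_embedding:
  assumes "fin_simple_graph F" "no_isolated_verts F" "fin_simple_graph G"
    and "inj_on \<phi> (verts F)" "(`) \<phi> ` edges F \<subseteq> edges G"
  shows "copy_in F G (\<phi> ` verts F, (`) \<phi> ` edges F)"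
proof -
  have "\<phi> v \<in> verts G" if v: "v \<in> verts F" for v
  proof -
    obtain e where e: "e \<in> edges F" "v \<in> e"
      using v assms(2) by (auto simp: no_isolated_verts_def)
    then have "\<phi> ` e \<in> edges G" using assms(5) by auto
    then show ?thesis using fin_simple_graph_edgeD(1)[OF assms(3)] e(2) by auto
  qed
  then show ?thesis
    using assms fin_simple_graph_image[OF assms(1,4)]
    by (auto simp: copy_in_def subgraph_def graph_iso_def bij_betw_def)
qed

lemma copy_inE:
  assumes "copy_in F G G'"
  obtains \<phi> where "inj_on \<phi> (verts F)" "verts G' = \<phi> ` verts F" "edges G' = (`) \<phi> ` edges F"
    "fin_simple_graph F" "subgraph G' G"
  using assms by (auto simp: copy_in_def graph_iso_def bij_betw_def)

lemma card_edges_iso: "graph_iso G H \<Longrightarrow> card (edges G) = card (edges H)"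
  using inj_on_image_edges[of G] unfolding graph_iso_def bij_betw_def by (metis card_image)

lemma card_edges_copy: "copy_in F G G' \<Longrightarrow> card (edges G') = card (edges F)"
  using card_edges_iso[of F G'] by (simp add: copy_in_def)

text \<open>Since \<open>f\<close> is not required to map edges to edges here, the constant map \<open>{}\<close> is covered, which
  yields the copy demanded by the first conjunct of \<^const>\<open>unavoidable\<close>.\<close>

lemma unavoidableI:
  assumes "fin_simple_graph F" "no_isolated_verts F" "fin_simple_graph G"
    and emb: "\<And>f. \<forall>e\<in>edges G. f e \<noteq> e \<Longrightarrow>
      \<exists>\<phi>. inj_on \<phi> (verts F) \<and> (`) \<phi> ` edges F \<subseteq> edges G \<and> (\<forall>e\<in>edges F. f (\<phi> ` e) \<notin> (`) \<phi> ` edges F)"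
  shows "unavoidable F G"
proof -
  have *: "\<exists>G'. copy_in F G G' \<and> free_subgraph f G'" if f: "\<forall>e\<in>edges G. f e \<noteq> e" for f
  proof -
    obtain \<phi> where \<phi>: "inj_on \<phi> (verts F)" "(`) \<phi> ` edges F \<subseteq> edges G"
      "\<forall>e\<in>edges F. f (\<phi> ` e) \<notin> (`) \<phi> ` edges F" using emb[OF f] by (elim exE conjE)
    then have "free_subgraph f (\<phi> ` verts F, (`) \<phi> ` edges F)" by (simp add: free_subgraph_def)
    then show ?thesis using copy_in_embedding[OF assms(1-3) \<phi>(1,2)] by blast
  qed
  have "\<forall>e\<in>edges G. (\<lambda>_. {}) e \<noteq> e" using fin_simple_graph_edgeD(2)[OF assms(3)] by force
  from *[OF this] show ?thesis using * by (auto simp: unavoidable_def edge_maps_def)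
qed

lemma unavoidable_fin_simple_graph: "unavoidable F G \<Longrightarrow> fin_simple_graph G"
  by (auto simp: unavoidable_def copy_in_def subgraph_def)

lemma minimal_unavoidableD:
  assumes "minimal_unavoidable F G"
  shows "unavoidable F G" "subgraph G' G \<Longrightarrow> G' \<noteq> G \<Longrightarrow> \<not> unavoidable F G'"
  using assms unfolding minimal_unavoidable_def by blast+

text \<open>\<open>g\<close> may be partial: a value that equals \<open>e\<close> or lies outside
  \<open>edges G\<close> counts as undefined and is replaced by another edge \<open>h e\<close>.
  Such an edge exists because a copy of \<open>F\<close> gives \<open>G\<close> at least two
  edges.\<close>

lemma not_unavoidableI:
  assumes "card (edges F) \<ge> 2"
    and hit: "\<And>G'. copy_in F G G' \<Longrightarrow> \<exists>e\<in>edges G'. g e \<in> edges G' \<and> g e \<noteq> e"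
  shows "\<not> unavoidable F G"
proof
  assume un: "unavoidable F G"
  then obtain G' where G': "copy_in F G G'" by (auto simp: unavoidable_def)
  have sub: "edges H \<subseteq> edges G" if "copy_in F G H" for H
    using that by (auto simp: copy_in_def subgraph_def)
  have "card (edges G) \<ge> 2"
    using card_mono[OF finite_edges[OF unavoidable_fin_simple_graph[OF un]] sub[OF G']]
      card_edges_copy[OF G'] assms(1) by simp
  then have "\<exists>e'. e' \<in> edges G \<and> e' \<noteq> e" for e
    using card_mono[of "{e}" "edges G"] by fastforce
  then obtain h where h: "\<And>e. h e \<in> edges G \<and> h e \<noteq> e" by metis
  define f where "f = restrict (\<lambda>e. if g e \<in> edges G \<and> g e \<noteq> e then g e else h e) (edges G)"
  have "f \<in> edge_maps G" using h by (auto simp: f_def edge_maps_def)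
  then obtain H where H: "copy_in F G H" "free_subgraph f H" using un by (auto simp: unavoidable_def)
  obtain e where e: "e \<in> edges H" "g e \<in> edges H" "g e \<noteq> e" using hit[OF H(1)] by blast
  then have "f e = g e" using sub[OF H(1)] by (simp add: f_def subset_iff)
  then show False using H(2) e by (auto simp: free_subgraph_def)
qed

lemma graph_iso_refl: "fin_simple_graph G \<Longrightarrow> graph_iso G G"
  unfolding graph_iso_def by (auto simp: bij_betw_def intro!: exI[of _ "\<lambda>x. x"])

lemma graph_iso_trans: "graph_iso G H \<Longrightarrow> graph_iso H K \<Longrightarrow> graph_iso G K"
  unfolding graph_iso_def
proof (elim conjE exE, intro conjI)
  fix \<phi> \<psi> assume *: "bij_betw \<phi> (verts G) (verts H)" "(`) \<phi> ` edges G = edges H"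
    "bij_betw \<psi> (verts H) (verts K)" "(`) \<psi> ` edges H = edges K"
  have "(`) (\<psi> \<circ> \<phi>) ` edges G = edges K"
    unfolding *(4)[symmetric] *(2)[symmetric] by (simp add: image_comp image_image)
  then show "\<exists>\<phi>. bij_betw \<phi> (verts G) (verts K) \<and> (`) \<phi> ` edges G = edges K"
    using bij_betw_trans[OF *(1,3)] by blast
qed

lemma graph_iso_sym: "graph_iso G H \<Longrightarrow> graph_iso H G"
  unfolding graph_iso_def
proof (elim conjE exE, intro conjI)
  fix \<phi> assume *: "bij_betw \<phi> (verts G) (verts H)" "(`) \<phi> ` edges G = edges H" "fin_simple_graph G"
  let ?\<psi> = "inv_into (verts G) \<phi>"
  have "?\<psi> ` \<phi> ` e = e" if "e \<in> edges G" for e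
    using inv_into_image_cancel[OF bij_betw_imp_inj_on[OF *(1)] fin_simple_graph_edgeD(1)[OF *(3) that]] .
  then have "(`) ?\<psi> ` edges H = edges G" unfolding *(2)[symmetric] image_image
    by (simp cong: image_cong)
  then show "\<exists>\<phi>. bij_betw \<phi> (verts H) (verts G) \<and> (`) \<phi> ` edges H = edges G"
    using bij_betw_inv_into[OF *(1)] by blast
qed

lemma subgraph_trans: "subgraph G H \<Longrightarrow> subgraph H K \<Longrightarrow> subgraph G K"
  by (auto simp: subgraph_def)

section \<open>Criteria for finitely or infinitely many minimal unavoidable graphs\<close>

lemma minimal_unavoidable_exists:
  assumes "unavoidable F G"
  shows "\<exists>G'. subgraph G' G \<and> minimal_unavoidable F G'"
  using assms
proof (induction "card (verts G) + card (edges G)" arbitrary: G rule: less_induct)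
  case less
  have fG: "fin_simple_graph G" by (rule unavoidable_fin_simple_graph[OF less.prems])
  show ?case
  proof (cases "minimal_unavoidable F G")
    case True
    moreover have "subgraph G G" using fG by (simp add: subgraph_def)
    ultimately show ?thesis by blast
  next
    case False
    then obtain G' where G': "subgraph G' G" "G' \<noteq> G" "unavoidable F G'"
      using less.prems by (auto simp: minimal_unavoidable_def)
    have fin: "finite (verts G)" "finite (edges G)"
      using fG finite_edges[OF fG] by (auto simp: fin_simple_graph_def)
    have le: "card (verts G') \<le> card (verts G)" "card (edges G') \<le> card (edges G)"
      using G'(1) fin by (auto simp: subgraph_def intro: card_mono)
    have "verts G' \<noteq> verts G \<or> edges G' \<noteq> edges G"  using G'(2) by (simp add: prod_eq_iff)
    then have "card (verts G') < card (verts G) \<or> card (edges G') < card (edges G)"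
      using G'(1) fin by (auto simp: subgraph_def intro: psubset_card_mono)
    then have "card (verts G') + card (edges G') < card (verts G) + card (edges G)"
      using le by linarith
    from less.hyps[OF this G'(3)] show ?thesis using subgraph_trans[OF _ G'(1)] by blast
  qed
qed

lemma min_unavoidables_alt:
  "min_unavoidables F = (\<lambda>G :: nat graph. {G'. graph_iso G G'}) ` {G. minimal_unavoidable F G}"
  by (simp add: min_unavoidables_def quotient_def UNION_singleton_eq_range Image_def)

text \<open>Every unavoidable graph contains a minimal one, so the hypothesis yields minimal ones
  with arbitrarily many edges. The number of edges is an isomorphism invariant, and finitely many
  classes would bound it.\<close>

lemma infinite_min_unavoidables:
  assumes "\<And>n. \<exists>G :: nat graph. unavoidable F G \<and>
    (\<forall>G'. subgraph G' G \<and> unavoidable F G' \<longrightarrow> n \<le> card (edges G'))"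
  shows "infinite (min_unavoidables F)"
proof
  assume fin: "finite (min_unavoidables F)"
  define m where "m = (\<lambda>X :: nat graph set. card (edges (SOME G. G \<in> X)))"
  have m: "m {G'. graph_iso G G'} = card (edges G)" if "minimal_unavoidable F G" for G :: "nat graph"
  proof -
    have "graph_iso G G" using that unavoidable_fin_simple_graph[of F G] graph_iso_refl[of G]
      by (simp add: minimal_unavoidable_def)
    then have "graph_iso G (SOME G' :: nat graph. G' \<in> {G'. graph_iso G G'})"
      using someI[of "graph_iso G" G] by simp
    then show ?thesis unfolding m_def by (rule card_edges_iso[symmetric])
  qed
  obtain n where n: "\<forall>x\<in>m ` min_unavoidables F. x < n"
    using finite_nat_set_iff_bounded fin by (metis finite_imageI)
  obtain G :: "nat graph" where G: "unavoidable F G"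
    "\<forall>G'. subgraph G' G \<and> unavoidable F G' \<longrightarrow> n \<le> card (edges G')" using assms[of n] by blast
  obtain G' where G': "subgraph G' G" "minimal_unavoidable F G'"
    using minimal_unavoidable_exists[OF G(1)] by blast
  then have "n \<le> card (edges G')" using G(2) unfolding minimal_unavoidable_def by blast
  moreover have "card (edges G') \<in> m ` min_unavoidables F"
    using m[OF G'(2), symmetric] G'(2) unfolding min_unavoidables_alt by blast
  ultimately show False using n by fastforce
qed

text \<open>Relabelling the vertices by numbers below \<open>N\<close> gives each class a
  representative in one fixed finite set.\<close>

lemma finite_min_unavoidables:
  assumes "\<And>G :: nat graph. minimal_unavoidable F G \<Longrightarrow> card (verts G) \<le> N"
  shows "finite (min_unavoidables F)"
proof (rule finite_subset)
  let ?S = "{..<N} :: nat set"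
  show "min_unavoidables F \<subseteq> (\<lambda>G. {G'. graph_iso G G'}) ` (Pow ?S \<times> Pow (Pow ?S))"
    unfolding min_unavoidables_alt
  proof (rule image_subsetI)
    fix G :: "nat graph" assume "G \<in> {G. minimal_unavoidable F G}"
    then have G: "card (verts G) \<le> N" "fin_simple_graph G"
      using assms[of G] unavoidable_fin_simple_graph[of F G] by (auto simp: minimal_unavoidable_def)
    then obtain \<phi> where \<phi>: "inj_on \<phi> (verts G)" "\<phi> ` verts G \<subseteq> ?S"
      using card_le_inj[of "verts G" ?S] by (auto simp: fin_simple_graph_def)
    let ?H = "(\<phi> ` verts G, (`) \<phi> ` edges G)"
    have iso: "graph_iso G ?H"
      using fin_simple_graph_image[OF G(2) \<phi>(1)] G(2) \<phi>(1)
      by (auto simp: graph_iso_def bij_betw_def)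
    then have "{G'. graph_iso G G'} = {G'. graph_iso ?H G'}"
      using graph_iso_trans[OF iso] graph_iso_trans[OF graph_iso_sym[OF iso]] by (intro Collect_cong iffI)
    moreover have "?H \<in> Pow ?S \<times> Pow (Pow ?S)"
      using \<phi>(2) fin_simple_graph_edgeD(1)[OF G(2)] by fastforce
    ultimately show "{G'. graph_iso G G'} \<in> (\<lambda>G. {G'. graph_iso G G'}) ` (Pow ?S \<times> Pow (Pow ?S))"
      by blast
  qed
qed auto

section \<open>Matchings\<close>

lemma disjoint_mem_eq: "disjoint A \<Longrightarrow> a \<in> A \<Longrightarrow> b \<in> A \<Longrightarrow> x \<in> a \<Longrightarrow> x \<in> b \<Longrightarrow> a = b"
  unfolding disjoint_def by blast

lemma graph_iso_tK2I:
  assumes "fin_simple_graph G" "disjoint (edges G)" "verts G = \<Union> (edges G)" "card (edges G) = t"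
  shows "graph_iso (tK2 t) G"
proof -
  obtain h where h: "bij_betw h {..<t} (edges G)"
    using ex_bij_betw_nat_finite[OF finite_edges[OF assms(1)]] assms(4) by (auto simp: atLeast0LessThan)
  have "\<exists>a b. a \<noteq> b \<and> h i = {a, b}" if "i < t" for i
    using fin_simple_graph_edgeD(2)[OF assms(1), of "h i"] bij_betwE[OF h] that
    by (auto simp: card_2_iff)
  then obtain a b where ab: "\<And>i. i < t \<Longrightarrow> a i \<noteq> b i" "\<And>i. i < t \<Longrightarrow> h i = {a i, b i}" by metis
  define \<phi> where "\<phi> n = (if even n then a (n div 2) else b (n div 2))" for n
  have \<phi>: "\<phi> (2 * i) = a i" "\<phi> (Suc (2 * i)) = b i" for i by (auto simp: \<phi>_def)
  have h_eq: "i = j" if "i < t" "j < t" "x \<in> h i" "x \<in> h j" for i j x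
    using disjoint_mem_eq[OF assms(2) _ _ that(3,4)] bij_betwE[OF h] that(1,2) bij_betw_imp_inj_on[OF h]
    by (auto dest: inj_onD)
  have mem: "\<phi> n \<in> h (n div 2)" if "n < 2 * t" for n
    using ab(2)[of "n div 2"] that by (auto simp: \<phi>_def)
  have "inj_on \<phi> {..<2 * t}"
  proof (rule inj_onI)
    fix m n assume mn: "m \<in> {..<2 * t}" "n \<in> {..<2 * t}" "\<phi> m = \<phi> n"
    then have d: "m div 2 = n div 2" using h_eq[of "m div 2" "n div 2" "\<phi> m"] mem[of m] mem[of n] by auto
    then have "even m = even n" using mn ab(1)[of "m div 2"] by (auto simp: \<phi>_def split: if_splits)
    then show "m = n" using d by (metis dvd_div_mult_self odd_two_times_div_two_succ even_two_times_div_two)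
  qed
  moreover have "\<phi> ` {..<2 * t} = \<Union> (edges G)"
  proof
    show "\<phi> ` {..<2 * t} \<subseteq> \<Union> (edges G)" using mem bij_betwE[OF h] by (fastforce)
    show "\<Union> (edges G) \<subseteq> \<phi> ` {..<2 * t}"
    proof
      fix x assume "x \<in> \<Union> (edges G)"
      then obtain i where i: "i < t" "x \<in> h i"
        using bij_betw_imp_surj_on[OF h] by blast
      then consider "x = \<phi> (2 * i)" | "x = \<phi> (Suc (2 * i))" using ab(2)[of i] \<phi>[of i] by auto
      then show "x \<in> \<phi> ` {..<2 * t}" using i by cases auto
    qed
  qed
  moreover have "(`) \<phi> ` edges (tK2 t) = edges G"
  proof -
    have "(`) \<phi> ` edges (tK2 t) = h ` {..<t}"
      unfolding tK2_def snd_conv image_image by (rule image_cong) (auto simp: \<phi> ab(2))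
    then show ?thesis using bij_betw_imp_surj_on[OF h] by simp
  qed
  moreover have "fin_simple_graph (tK2 t)" by (auto simp: tK2_def fin_simple_graph_def)
  ultimately show ?thesis using assms(1,3) by (auto simp: graph_iso_def bij_betw_def tK2_def)
qed

lemma graph_iso_tK2D:
  assumes "graph_iso (tK2 t) G"
  shows "disjoint (edges G)" "verts G = \<Union> (edges G)" "card (edges G) = t"
proof -
  obtain \<phi> where \<phi>: "inj_on \<phi> (verts (tK2 t))" "verts G = \<phi> ` verts (tK2 t)"
    "edges G = (`) \<phi> ` edges (tK2 t)"
    using assms by (auto simp: graph_iso_def bij_betw_def)
  have V: "verts (tK2 t) = {..<2 * t}" by (simp add: tK2_def)
  have E: "edges G = (\<lambda>i. {\<phi> (2 * i), \<phi> (2 * i + 1)}) ` {..<t}"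
    by (simp add: \<phi>(3) tK2_def image_image)
  have inj: "\<phi> m = \<phi> n \<longleftrightarrow> m = n" if "m < 2 * t" "n < 2 * t" for m n
    using \<phi>(1) that by (auto simp: V inj_on_def)
  show "disjoint (edges G)"
  proof (rule disjointI)
    fix e e' assume "e \<in> edges G" "e' \<in> edges G" "e \<noteq> e'"
    then obtain i j where ij: "i < t" "j < t" "e = {\<phi> (2 * i), \<phi> (2 * i + 1)}"
      "e' = {\<phi> (2 * j), \<phi> (2 * j + 1)}" "i \<noteq> j" unfolding E by blast
    moreover have "2 * i \<noteq> 2 * j + 1" "2 * j \<noteq> 2 * i + 1" by presburger+
    ultimately show "e \<inter> e' = {}" using inj by auto
  qed
  have "{..<2 * t} = (\<Union>i<t. {2 * i, 2 * i + 1})"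
  proof (intro subset_antisym subsetI)
    fix n assume n: "n \<in> {..<2 * t}"
    have "n = 2 * (n div 2) \<or> n = 2 * (n div 2) + 1" by presburger
    then show "n \<in> (\<Union>i<t. {2 * i, 2 * i + 1})" using n by auto
  qed auto
  then show "verts G = \<Union> (edges G)" unfolding \<phi>(2) V E by (auto simp: image_UN)
  have "inj_on (\<lambda>i. {2 * i, 2 * i + 1 :: nat}) {..<t}"
    by (auto simp: inj_on_def doubleton_eq_iff)
  then have "card (edges (tK2 t)) = t" by (simp add: tK2_def card_image)
  then show "card (edges G) = t" using card_edges_iso[OF assms] by simp
qed

definition matching_of_size :: "nat \<Rightarrow> 'a set set \<Rightarrow> 'a set set \<Rightarrow> bool" where
  "matching_of_size t E M \<longleftrightarrow> M \<subseteq> E \<and> disjoint M \<and> card M = t"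

lemma copy_in_matching:
  assumes "graph_iso F (tK2 t)" "fin_simple_graph G" "matching_of_size t (edges G) M"
  shows "copy_in F G (\<Union> M, M)"
proof -
  have "fin_simple_graph (\<Union> M, M)" "\<Union> M \<subseteq> verts G"
    using assms(2,3) finite_subset[of "\<Union> M" "verts G"]
    by (auto simp: fin_simple_graph_def matching_of_size_def)
  moreover from this have "graph_iso (tK2 t) (\<Union> M, M)"
    using assms(3) by (intro graph_iso_tK2I) (auto simp: matching_of_size_def)
  ultimately show ?thesis using graph_iso_trans[OF assms(1)] assms(2,3)
    by (auto simp: copy_in_def subgraph_def matching_of_size_def)
qed

lemma matching_copy_in:
  assumes "graph_iso F (tK2 t)" "copy_in F G G'"
  shows "matching_of_size t (edges G) (edges G')"
proof -
  have "graph_iso (tK2 t) G'" "edges G' \<subseteq> edges G"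
    using graph_iso_trans[OF graph_iso_sym[OF assms(1)], of G'] assms(2)
    by (auto simp: copy_in_def subgraph_def)
  then show ?thesis using graph_iso_tK2D[of t G'] by (simp add: matching_of_size_def)
qed

text \<open>A copy of a matching amounts to a set of \<open>t\<close> disjoint edges, so vertex sets
  can be ignored from here on.\<close>

lemma unavoidable_matching_iff:
  assumes "graph_iso F (tK2 t)" "fin_simple_graph G"
  shows "unavoidable F G \<longleftrightarrow> (\<exists>M. matching_of_size t (edges G) M) \<and>
    (\<forall>f\<in>edge_maps G. \<exists>M. matching_of_size t (edges G) M \<and> (\<forall>e\<in>M. f e \<notin> M))"
proof
  assume "unavoidable F G"
  then show "(\<exists>M. matching_of_size t (edges G) M) \<and>
    (\<forall>f\<in>edge_maps G. \<exists>M. matching_of_size t (edges G) M \<and> (\<forall>e\<in>M. f e \<notin> M))"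
    unfolding unavoidable_def free_subgraph_def using matching_copy_in[OF assms(1)] by metis
next
  assume *: "(\<exists>M. matching_of_size t (edges G) M) \<and>
    (\<forall>f\<in>edge_maps G. \<exists>M. matching_of_size t (edges G) M \<and> (\<forall>e\<in>M. f e \<notin> M))"
  have "\<exists>G'. copy_in F G G' \<and> free_subgraph f G'" if f: "f \<in> edge_maps G" for f
  proof -
    obtain M where "matching_of_size t (edges G) M" "\<forall>e\<in>M. f e \<notin> M" using * f by blast
    then show ?thesis using copy_in_matching[OF assms, of M]
      by (intro exI[of _ "(\<Union> M, M)"]) (simp add: free_subgraph_def)
  qed
  then show "unavoidable F G"
    unfolding unavoidable_def using copy_in_matching[OF assms] * by blast
qed

section \<open>Degree and size bounds for minimal unavoidable graphs of a matching\<close>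

lemma matching_exchange:
  assumes "\<forall>e\<in>E. card e = 2" "finite E" "matching_of_size t E M" "e \<in> M" "b \<in> e"
    and "K \<subseteq> incident E b" "3 * t \<le> card K" "finite Z" "card Z \<le> t"
  shows "\<exists>e'\<in>K. e' \<notin> Z \<and> matching_of_size t E (insert e' (M - {e}))"
proof -
  let ?M = "M - {e}"
  have M: "M \<subseteq> E" "disjoint M" "card M = t" "finite M"
    using assms(2,3) finite_subset by (auto simp: matching_of_size_def)
  have t: "t > 0" "card ?M = t - 1" using M assms(4) by (auto simp: card_gt_0_iff)
  let ?U = "\<Union> ?M"
  have b: "b \<notin> ?U" using disjoint_mem_eq[OF M(2) assms(4)] assms(5) by blast
  have "card ?U \<le> sum card ?M" by (rule card_Union_le_sum_card)
  also have "\<dots> = (\<Sum>e\<in>?M. 2)" using M(1) assms(1) by (intro sum.cong) auto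
  also have "\<dots> = 2 * (t - 1)" using t by simp
  finally have U: "card ?U \<le> 2 * (t - 1)" .
  have finU: "finite ?U" using M assms(1) card.infinite by (intro finite_Union) force+
  \<comment> \<open>The new edge has to avoid \<open>Z\<close> and the edges from \<open>b\<close>
    to the at most \<open>2 * (t - 1)\<close> vertices covered by the rest of the matching: fewer
    than \<open>3 * t\<close> edges in all.\<close>
  have "card (Z \<union> (\<lambda>x. {b, x}) ` ?U) \<le> t + 2 * (t - 1)"
    using card_Un_le[of Z "(\<lambda>x. {b, x}) ` ?U"] card_image_le[OF finU, of "\<lambda>x. {b, x}"] U assms(9)
    by linarith
  also have "\<dots> < card K" using t(1) assms(7) by linarith
  finally have "\<not> K \<subseteq> Z \<union> (\<lambda>x. {b, x}) ` ?U"
    using card_mono[of "Z \<union> (\<lambda>x. {b, x}) ` ?U" K] finU assms(8) by auto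
  then obtain e' where e': "e' \<in> K" "e' \<notin> Z" "e' \<notin> (\<lambda>x. {b, x}) ` ?U" by blast
  then have e'E: "e' \<in> E" "b \<in> e'" using assms(6) by (auto simp: incident_def)
  then obtain x where x: "e' = {b, x}" using edge_other_endpoint assms(1) by metis
  then have disj: "e' \<inter> ?U = {}" using e'(3) b by auto
  then have "e' \<notin> ?M" using e'E by auto
  then have "card (insert e' ?M) = t" using t M(4) by simp
  moreover have "disjoint (insert e' ?M)"
    using disj M(2) unfolding disjoint_def by blast
  ultimately show ?thesis using e'(1,2) e'E(1) M(1)
    by (intro bexI[of _ e']) (auto simp: matching_of_size_def)
qed

text \<open>If \<open>b\<close> has huge degree, an edge \<open>e\<close> at \<open>b\<close> can be deleted: a bad map \<open>f\<close> on the rest is extended to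
  \<open>e\<close> by the most popular value of \<open>f\<close> on the edges at \<open>b\<close>, and then \<open>e\<close> can be exchanged for another
  edge at \<open>b\<close> in any free matching.\<close>

lemma minimal_unavoidable_matching_degree:
  assumes "graph_iso F (tK2 t)" "minimal_unavoidable F G"
  shows "card (incident (edges G) b) \<le> 3 * t * t + 3 * t + 1"
proof (rule ccontr)
  assume big: "\<not> ?thesis"
  have un: "unavoidable F G" by (rule minimal_unavoidableD(1)[OF assms(2)])
  have fG: "fin_simple_graph G" by (rule unavoidable_fin_simple_graph[OF un])
  define E where "E = edges G"
  have E: "\<forall>e\<in>E. card e = 2" "finite E"
    using fG finite_edges[OF fG] by (auto simp: E_def fin_simple_graph_def)
  define B where "B = incident E b"
  have B: "finite B" "B \<subseteq> E" using E by (auto simp: B_def incident_def)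
  have cB: "card B \<ge> 3 * t * t + 3 * t + 2" using big by (simp add: B_def E_def)
  then obtain e where e: "e \<in> B" by fastforce
  then have eE: "e \<in> E" "b \<in> e" by (auto simp: B_def incident_def)
  define G' where "G' = (verts G, E - {e})"
  have fG': "fin_simple_graph G'" "edges G' = E - {e}"
    using fG by (auto simp: G'_def E_def fin_simple_graph_def)
  have cB': "card (B - {e}) \<ge> 3 * t * t + 3 * t + 1" using cB e B by simp
  have "subgraph G' G" using fG fG' by (auto simp: subgraph_def G'_def E_def)
  moreover have "edges G' \<noteq> edges G" using fG'(2) eE(1) by (auto simp: E_def)
  then have "G' \<noteq> G" by metis
  ultimately have "\<not> unavoidable F G'" by (rule minimal_unavoidableD(2)[OF assms(2)])
  then consider (none) "\<nexists>M. matching_of_size t (E - {e}) M"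
    | (bad) f where "f \<in> edge_maps G'" "\<nexists>M. matching_of_size t (E - {e}) M \<and> (\<forall>e\<in>M. f e \<notin> M)"
    using unavoidable_matching_iff[OF assms(1) fG'(1)] fG'(2) by auto
  then show False
  proof cases
    case none
    obtain M where M: "matching_of_size t E M"
      using un unavoidable_matching_iff[OF assms(1) fG] by (auto simp: E_def)
    then have "e \<in> M" using none by (auto simp: matching_of_size_def)
    moreover have "B - {e} \<subseteq> incident E b" by (auto simp: B_def)
    ultimately obtain e' where e': "e' \<in> B - {e}" "matching_of_size t E (insert e' (M - {e}))"
      using matching_exchange[OF E M _ eE(2), of "B - {e}" "{}"] cB' by auto
    then show False using none by (auto simp: matching_of_size_def)
  next
    case bad
    define c where "c = (\<lambda>g. card {e' \<in> B - {e}. f e' = g})"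
    have "card (B - {e}) \<le> card (E - {e})" using B(2) E(2) by (intro card_mono) auto
    then have "E - {e} \<noteq> {}" using cB' by (metis card.empty le_zero_eq add_is_0 one_neq_zero le_trans)
    then have "Max (c ` (E - {e})) \<in> c ` (E - {e})" using E(2) by (intro Max_in) auto
    then obtain g where g: "g \<in> E - {e}" "c g = Max (c ` (E - {e}))" by (metis imageE)
    have g_max: "c g' \<le> c g" if "g' \<in> E - {e}" for g'
      unfolding g(2) using that E(2) by (intro Max_ge) auto
    have fm: "\<And>x. x \<in> E - {e} \<Longrightarrow> f x \<in> E - {e} \<and> f x \<noteq> x" "f \<in> extensional (E - {e})"
      using bad(1) fG'(2) by (auto simp: edge_maps_def PiE_def)
    have "f(e := g) \<in> edge_maps G"
      unfolding edge_maps_def E_def[symmetric] PiE_def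
      using fm g(1) eE(1) by (auto simp: extensional_def Pi_iff)
    then obtain M where M: "matching_of_size t E M" "\<forall>x\<in>M. (f(e := g)) x \<notin> M"
      using bspec[OF conjunct2[OF iffD1[OF unavoidable_matching_iff[OF assms(1) fG] un]]]
      unfolding E_def by blast
    have fM: "f x \<notin> M" if "x \<in> M" "x \<noteq> e" for x using bspec[OF M(2) that(1)] that(2) by simp
    let ?M = "M - {e}"
    have finM: "finite M" using M(1) E(2) finite_subset by (auto simp: matching_of_size_def)
    have eM: "e \<in> M"
    proof (rule ccontr)
      assume "e \<notin> M"
      then have "matching_of_size t (E - {e}) M \<and> (\<forall>x\<in>M. f x \<notin> M)"
        using M(1) fM by (auto simp: matching_of_size_def)
      then show False using bad(2) by blast
    qed
    have g_M: "g \<notin> ?M" using bspec[OF M(2) eM] by simp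
    have cM: "card ?M \<le> t" using M(1) finM card_Diff1_le[of M e] by (simp add: matching_of_size_def)
    \<comment> \<open>Only an edge that \<open>f\<close> does not send into the remaining matching
      can replace \<open>e\<close>. Since \<open>g \<notin> ?M\<close>, all preimages of
      \<open>g\<close> at \<open>b\<close> qualify. If they are fewer than \<open>3 * t\<close>, so
      are those of every other value, and at most \<open>t * (3 * t)\<close> edges are excluded; the
      degree bound leaves \<open>3 * t\<close> for the exchange.\<close>
    define K where "K = {e' \<in> B - {e}. f e' \<notin> ?M}"
    have "3 * t \<le> card K"
    proof (cases "3 * t \<le> c g")
      case True
      have "c g \<le> card K" unfolding c_def K_def using g_M B(1) by (intro card_mono) auto
      then show ?thesis using True by simp
    next
      case False
      have "B - {e} - K = (\<Union>m\<in>?M. {e' \<in> B - {e}. f e' = m})" by (auto simp: K_def)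
      then have "card (B - {e} - K) \<le> (\<Sum>m\<in>?M. c m)"
        unfolding c_def using card_UN_le[of ?M] finM by auto
      also have "\<dots> \<le> (\<Sum>m\<in>?M. 3 * t)"
      proof (rule sum_mono)
        fix m assume "m \<in> ?M"
        then have "m \<in> E - {e}" using M(1) by (auto simp: matching_of_size_def)
        then show "c m \<le> 3 * t" using g_max[of m] False by simp
      qed
      also have "\<dots> \<le> t * (3 * t)" using cM by simp
      finally have "card (B - {e} - K) \<le> 3 * t * t" by simp
      moreover have "card (B - {e}) = card (B - {e} - K) + card K"
      proof -
        have K: "K \<subseteq> B - {e}" by (auto simp: K_def)
        show ?thesis using card_Diff_subset[OF finite_subset[OF K] K] card_mono[OF _ K] B(1) by simp
      qed
      ultimately show ?thesis using cB' by linarith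
    qed
    moreover have "K \<subseteq> incident E b" by (auto simp: K_def B_def)
    \<comment> \<open>Taking the images of the remaining matching as \<open>Z\<close> ensures that
      no old edge is sent to the new one.\<close>
    moreover have "card (f ` ?M) \<le> t" using card_image_le[of ?M f] finM cM by simp
    ultimately obtain e' where e': "e' \<in> K" "e' \<notin> f ` ?M" "matching_of_size t E (insert e' ?M)"
      using matching_exchange[OF E M(1) eM eE(2), of K "f ` ?M"] finM by auto
    have "e' \<in> E - {e}" using e'(1) B(2) by (auto simp: K_def)
    then have "f e' \<noteq> e'" using fm(1) by blast
    then have "\<forall>x\<in>insert e' ?M. f x \<notin> insert e' ?M"
      using e'(1,2) fM by (auto simp: K_def)
    moreover have "matching_of_size t (E - {e}) (insert e' ?M)"
      using e'(3) \<open>e' \<in> E - {e}\<close> by (auto simp: matching_of_size_def)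
    ultimately show False using bad(2) by blast
  qed
qed

lemma minimal_unavoidable_matching_verts:
  assumes "graph_iso F (tK2 t)" "minimal_unavoidable F G"
  shows "verts G = \<Union> (edges G)"
proof (rule ccontr)
  assume neq: "\<not> ?thesis"
  have un: "unavoidable F G" by (rule minimal_unavoidableD(1)[OF assms(2)])
  have fG: "fin_simple_graph G" by (rule unavoidable_fin_simple_graph[OF un])
  let ?H = "(\<Union> (edges G), edges G)"
  have sub: "\<Union> (edges G) \<subseteq> verts G" using fG by (auto simp: fin_simple_graph_def)
  then have fH: "fin_simple_graph ?H"
    using fG finite_subset[OF sub] by (auto simp: fin_simple_graph_def)
  have "unavoidable F ?H"
    using un unavoidable_matching_iff[OF assms(1) fG] unavoidable_matching_iff[OF assms(1) fH]
    by (simp add: edge_maps_def)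
  moreover have "subgraph ?H G" using fH fG sub by (simp add: subgraph_def)
  moreover have "?H \<noteq> G" using neq by (metis fst_conv)
  ultimately show False using assms(2) unfolding minimal_unavoidable_def by blast
qed

lemma minimal_unavoidable_large_matching:
  assumes "graph_iso F (tK2 t)" "minimal_unavoidable F G" "matching_of_size (3 * t) (edges G) M"
  shows "edges G = M"
proof -
  have fG: "fin_simple_graph G"
    by (rule unavoidable_fin_simple_graph[OF minimal_unavoidableD(1)[OF assms(2)]])
  let ?H = "(\<Union> M, M)"
  have M: "M \<subseteq> edges G" "disjoint M" "card M = 3 * t" "finite M"
    using assms(3) finite_edges[OF fG] finite_subset by (auto simp: matching_of_size_def)
  have sub: "\<Union> M \<subseteq> verts G" using fG M(1) by (auto simp: fin_simple_graph_def)
  then have fH: "fin_simple_graph ?H"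
    using fG M(1) finite_subset[OF sub] by (auto simp: fin_simple_graph_def)
  have *: "\<exists>I. matching_of_size t M I \<and> (\<forall>e\<in>I. f e \<notin> I)" if "\<forall>e\<in>M. f e \<noteq> e" for f
  proof -
    have "card ({f x} \<inter> M) \<le> 1" for x by (rule order_trans[OF card_mono[of "{f x}"]]) auto
    then obtain I where I: "I \<subseteq> M" "card I = t" "\<forall>x\<in>I. \<forall>y\<in>I. y \<in> {f x} \<longrightarrow> y = x"
      using independent_subset[OF M(4), of "\<lambda>x. {f x}" 1 t] M(3) by auto
    moreover have "disjoint I" using M(2) I(1) unfolding disjoint_def by blast
    moreover have "\<forall>e\<in>I. f e \<notin> I"
    proof (intro ballI notI)
      fix e assume e: "e \<in> I" "f e \<in> I"
      then have "f e = e" using I(3) by simp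
      then show False using bspec[OF that, of e] I(1) e(1) by auto
    qed
    ultimately show ?thesis using I(1,2) by (intro exI[of _ I]) (simp add: matching_of_size_def)
  qed
  \<comment> \<open>The constant map \<open>{}\<close> fixes no edge, so \<open>*\<close> also
    supplies the plain matching required when \<open>edge_maps ?H\<close> is empty.\<close>
  have "\<forall>e\<in>M. (\<lambda>_. {}) e \<noteq> e" using M(1) fG by (force simp: fin_simple_graph_def)
  from *[OF this] have "\<exists>I. matching_of_size t M I" by blast
  moreover have "\<exists>I. matching_of_size t M I \<and> (\<forall>e\<in>I. f e \<notin> I)" if "f \<in> edge_maps ?H" for f
    by (rule *) (use that in \<open>simp add: edge_maps_def\<close>)
  ultimately have "unavoidable F ?H"
    unfolding unavoidable_matching_iff[OF assms(1) fH] by simp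
  moreover have "subgraph ?H G" using fH fG sub M(1) by (simp add: subgraph_def)
  ultimately have "?H = G" using assms(2) unfolding minimal_unavoidable_def by blast
  then show ?thesis by (metis snd_conv)
qed

text \<open>Either the graph is a matching of \<open>3 * t\<close> edges, or a maximal matching is
  smaller and its at most \<open>6 * t\<close> vertices meet all edges, whose number the degree
  bound then limits. The sum in the edge bound covers both cases.\<close>

theorem finite_min_unavoidables_matching:
  assumes "graph_iso F (tK2 t)"
  shows "finite (min_unavoidables F)"
proof (rule finite_min_unavoidables)
  fix G :: "nat graph"
  assume min: "minimal_unavoidable F G"
  have fG: "fin_simple_graph G"
    by (rule unavoidable_fin_simple_graph[OF minimal_unavoidableD(1)[OF min]])
  let ?E = "edges G" and ?D = "3 * t * t + 3 * t + 1"
  have E: "finite ?E" "\<forall>e\<in>?E. card e = 2" "\<forall>e\<in>?E. finite e"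
    using finite_edges[OF fG] fin_simple_graph_edgeD[OF fG] by auto
  have union: "card (\<Union> M) \<le> 2 * card M" if "M \<subseteq> ?E" for M
  proof -
    have "card (\<Union> M) \<le> sum card M" by (rule card_Union_le_sum_card)
    also have "\<dots> = (\<Sum>e\<in>M. 2)" using that E(2) by (intro sum.cong) auto
    finally show ?thesis by simp
  qed
  have "card ?E \<le> 6 * t * ?D + 3 * t"
  proof (cases "\<exists>M. matching_of_size (3 * t) ?E M")
    case True
    then obtain M where M: "matching_of_size (3 * t) ?E M" by blast
    then show ?thesis
      using minimal_unavoidable_large_matching[OF assms min M] by (simp add: matching_of_size_def)
  next
    case False
    let ?P = "\<lambda>M. M \<subseteq> ?E \<and> disjoint M"
    have "finite {M. ?P M}" using E(1) by (auto intro: finite_subset[of _ "Pow ?E"])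
    moreover have "{M. ?P M} \<noteq> {}" by (auto intro: exI[of _ "{}"])
    ultimately obtain M where "M \<in> {M. ?P M}" and M_max: "\<forall>N\<in>{M. ?P M}. M \<subseteq> N \<longrightarrow> M = N"
      by (rule finite_has_maximal[THEN bexE])
    then have M: "?P M" by simp
    have "card M < 3 * t"
    proof (rule ccontr)
      assume "\<not> ?thesis"
      then obtain N where N: "N \<subseteq> M" "card N = 3 * t" by (metis obtain_subset_with_card_n not_less)
      then have "matching_of_size (3 * t) ?E N"
        using M unfolding matching_of_size_def disjoint_def by blast
      then show False using False by blast
    qed
    then have cU: "card (\<Union> M) \<le> 6 * t" using union[of M] M by linarith
    have "?E \<subseteq> (\<Union>v\<in>\<Union> M. incident ?E v)"
    proof
      fix e assume e: "e \<in> ?E"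
      have "e \<inter> \<Union> M \<noteq> {}"
      proof
        assume disj: "e \<inter> \<Union> M = {}"
        then have "?P (insert e M)" using e M unfolding disjoint_def by blast
        then have "e \<in> M" using bspec[OF M_max, of "insert e M"] by blast
        then have "e = {}" using disj by blast
        then show False using E(2) e by force
      qed
      then show "e \<in> (\<Union>v\<in>\<Union> M. incident ?E v)" using e by (auto simp: incident_def)
    qed
    moreover have finU: "finite (\<Union> M)" using M E finite_subset[of M ?E] by (intro finite_Union) auto
    ultimately have "card ?E \<le> card (\<Union>v\<in>\<Union> M. incident ?E v)"
      using E(1) by (intro card_mono finite_UN_I finite_incident)
    also have "\<dots> \<le> (\<Sum>v\<in>\<Union> M. card (incident ?E v))" by (rule card_UN_le[OF finU])
    also have "\<dots> \<le> (\<Sum>v\<in>\<Union> M. ?D)"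
      by (rule sum_mono) (rule minimal_unavoidable_matching_degree[OF assms min])
    also have "\<dots> \<le> 6 * t * ?D" using mult_right_mono[OF cU, of ?D] by simp
    finally show ?thesis by simp
  qed
  then show "card (verts G) \<le> 2 * (6 * t * ?D + 3 * t)"
    using minimal_unavoidable_matching_verts[OF assms min] union[of ?E] by simp
qed

section \<open>Forests\<close>

lemma forest_subgraph:
  assumes "forest G" "fin_simple_graph G'" "edges G' \<subseteq> edges G"
  shows "forest G'"
  using assms unfolding forest_def is_cycle_def by blast

text \<open>At the first vertex of a longest path, a second edge would lead back into the path and
  close a cycle with an initial segment.\<close>

lemma forest_ex_leaf:
  assumes "forest G" "verts G \<noteq> {}"
  shows "\<exists>v\<in>verts G. card (incident (edges G) v) \<le> 1"
proof (rule ccontr)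
  assume "\<not> ?thesis"
  then have deg: "card (incident (edges G) v) \<ge> 2" if "v \<in> verts G" for v using that by force
  have fG: "fin_simple_graph G" using assms(1) by (simp add: forest_def)
  have finV: "finite (verts G)" using fG by (simp add: fin_simple_graph_def)
  define P where "P vs \<longleftrightarrow> vs \<noteq> [] \<and> distinct vs \<and> set vs \<subseteq> verts G \<and>
    (\<forall>i. Suc i < length vs \<longrightarrow> {vs ! i, vs ! Suc i} \<in> edges G)" for vs
  obtain v where "v \<in> verts G" using assms(2) by blast
  then have "P [v]" by (simp add: P_def)
  moreover have "length vs \<le> card (verts G)" if "P vs" for vs
    using that card_mono[OF finV, of "set vs"] by (auto simp: P_def distinct_card)
  ultimately obtain vs where vs: "P vs" "\<And>ws. P ws \<Longrightarrow> length ws \<le> length vs"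
    using ex_has_greatest_nat[of P "[v]" length "Suc (card (verts G))"] by (auto simp: le_imp_less_Suc)
  let ?x = "vs ! 0"
  have x: "?x \<in> verts G" using vs(1) nth_mem[of 0 vs] by (auto simp: P_def)
  \<comment> \<open>For a one-vertex path \<open>vs ! 1\<close> is unspecified. This is harmless:
    two incident edges never fit into a singleton.\<close>
  have "\<not> incident (edges G) ?x \<subseteq> {{?x, vs ! 1}}"
    using card_mono[of "{{?x, vs ! 1}}" "incident (edges G) ?x"] deg[OF x] by auto
  then obtain e where e: "e \<in> edges G" "?x \<in> e" "e \<noteq> {?x, vs ! 1}" by (auto simp: incident_def)
  obtain u where u: "e = {?x, u}" "u \<noteq> ?x"
    using edge_other_endpoint[OF fin_simple_graph_edgeD(2)[OF fG e(1)] e(2)] .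
  have uV: "u \<in> verts G" using fin_simple_graph_edgeD(1)[OF fG e(1)] u by auto
  have "u \<in> set vs"
  proof (rule ccontr)
    assume "u \<notin> set vs"
    then have "P (u # vs)" using vs(1) e(1) u uV unfolding P_def
      by (auto simp: nth_Cons insert_commute split: nat.splits)
    then show False using vs(2) by fastforce
  qed
  then obtain j where j: "j < length vs" "vs ! j = u" by (auto simp: in_set_conv_nth)
  have "j \<noteq> 0" "j \<noteq> 1" using j u e(3) by auto
  then have "is_cycle G (take (Suc j) vs)"
    unfolding is_cycle_def
  proof (intro conjI allI impI)
    show "3 \<le> length (take (Suc j) vs)" using j \<open>j \<noteq> 0\<close> \<open>j \<noteq> 1\<close> by simp
    show "distinct (take (Suc j) vs)" using vs(1) by (simp add: P_def)
    fix i assume "i < length (take (Suc j) vs)"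
    then have "i \<le> j" by simp
    then consider "i = j" | "i < j" by linarith
    then show "{take (Suc j) vs ! i, take (Suc j) vs ! (Suc i mod length (take (Suc j) vs))} \<in> edges G"
    proof cases
      case 1
      then show ?thesis using j e(1) u by (simp add: insert_commute)
    next
      case 2
      then show ?thesis using j vs(1) by (simp add: P_def)
    qed
  qed
  then show False using assms(1) by (auto simp: forest_def)
qed

lemma forest_delete_vertex:
  assumes "forest G"
  shows "forest (verts G - {v}, edges G - incident (edges G) v)"
  using assms by (intro forest_subgraph[OF assms]) (auto simp: forest_def fin_simple_graph_def incident_def)

text \<open>Orient the edges of a forest away from the roots: each edge is owned by its tail, and the only
  edge at a vertex which is owned by its other endpoint leads to the parent.\<close>

lemma forest_owner:
  assumes "forest G"
  shows "\<exists>own. (\<forall>e\<in>edges G. own e \<in> e) \<and>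
    (\<forall>v. \<forall>e\<in>edges G. \<forall>e'\<in>edges G. v \<in> e \<longrightarrow> v \<in> e' \<longrightarrow> own e \<noteq> v \<longrightarrow> own e' \<noteq> v \<longrightarrow> e = e')"
  using assms
proof (induction "card (verts G)" arbitrary: G rule: less_induct)
  case less
  have fG: "fin_simple_graph G" using less.prems by (simp add: forest_def)
  show ?case
  proof (cases "verts G = {}")
    case True
    then have "edges G = {}" using fG by (fastforce simp: fin_simple_graph_def)
    then show ?thesis by simp
  next
    case False
    then obtain v where v: "v \<in> verts G" "card (incident (edges G) v) \<le> 1"
      using forest_ex_leaf[OF less.prems] by blast
    have v_uniq: "e = e'" if "e \<in> edges G" "e' \<in> edges G" "v \<in> e" "v \<in> e'" for e e'
      using v(2) that finite_edges[OF fG] by (auto simp: incident_def card_le_Suc0_iff_eq)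
    let ?G = "(verts G - {v}, edges G - incident (edges G) v)"
    have "card (verts ?G) < card (verts G)"
      using v(1) fG card_Diff1_less[of "verts G" v] by (simp add: fin_simple_graph_def)
    from less.hyps[OF this forest_delete_vertex[OF less.prems]]
    obtain own where own0: "\<forall>e\<in>edges ?G. own e \<in> e"
      "\<forall>w. \<forall>e\<in>edges ?G. \<forall>e'\<in>edges ?G. w \<in> e \<longrightarrow> w \<in> e' \<longrightarrow> own e \<noteq> w \<longrightarrow> own e' \<noteq> w \<longrightarrow> e = e'"
      by blast
    have mem: "e \<in> edges ?G" if "e \<in> edges G" "v \<notin> e" for e using that by (simp add: incident_def)
    have own: "\<And>e. e \<in> edges G \<Longrightarrow> v \<notin> e \<Longrightarrow> own e \<in> e"
      "\<And>w e e'. e \<in> edges G \<Longrightarrow> e' \<in> edges G \<Longrightarrow> v \<notin> e \<Longrightarrow> v \<notin> e' \<Longrightarrow> w \<in> e \<Longrightarrow> w \<in> e' \<Longrightarrow>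
        own e \<noteq> w \<Longrightarrow> own e' \<noteq> w \<Longrightarrow> e = e'"
      using own0 mem by metis+
    \<comment> \<open>An edge at the leaf \<open>v\<close> is owned by its other end, so no vertex
      except \<open>v\<close> gets a new edge that it does not own.\<close>
    define own' where "own' e = (if v \<in> e then SOME u. u \<in> e \<and> u \<noteq> v else own e)" for e
    have own': "e = {v, own' e} \<and> own' e \<noteq> v" if e: "e \<in> edges G" "v \<in> e" for e
    proof -
      obtain u where u: "e = {v, u}" "u \<noteq> v"
        using edge_other_endpoint[OF fin_simple_graph_edgeD(2)[OF fG e(1)] e(2)] .
      then have "(SOME u. u \<in> e \<and> u \<noteq> v) = u" by (intro some_equality) auto
      then show ?thesis using e(2) u by (simp add: own'_def)
    qed
    show ?thesis
    proof (intro exI[of _ own'] conjI ballI allI impI)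
      fix e assume e: "e \<in> edges G"
      show "own' e \<in> e"
      proof (cases "v \<in> e")
        case True
        then show ?thesis using own'[OF e] by blast
      next
        case False
        then show ?thesis using own(1)[OF e] by (simp add: own'_def)
      qed
    next
      fix w e e' assume *: "e \<in> edges G" "e' \<in> edges G" "w \<in> e" "w \<in> e'" "own' e \<noteq> w" "own' e' \<noteq> w"
      show "e = e'"
      proof (cases "w = v")
        case True
        then show ?thesis using v_uniq * by blast
      next
        case False
        have "v \<notin> e" "v \<notin> e'" using own'[OF *(1)] own'[OF *(2)] *(3-6) False by auto
        then show ?thesis using own(2)[OF *(1,2) _ _ *(3,4)] *(5,6) by (simp add: own'_def)
      qed
    qed
  qed
qed

text \<open>A vertex of degree below \<open>c\<close> takes fewer than \<open>c\<close> edges with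
  it, so deleting it preserves \<open>c * card V \<le> card E\<close>. This cannot exhaust
  \<open>V\<close>, because a single vertex carries no edges.\<close>

lemma ex_min_degree_subset:
  assumes "finite V" "V \<noteq> {}" "\<forall>e\<in>E. e \<subseteq> V \<and> card e = 2" "c * card V \<le> card E"
  shows "\<exists>W\<subseteq>V. W \<noteq> {} \<and> (\<forall>w\<in>W. c \<le> card {u \<in> W. {w, u} \<in> E})"
  using assms
proof (induction "card V" arbitrary: V E rule: less_induct)
  case less
  have finE: "finite E" using less.prems(1,3) by (intro finite_subset[of E "Pow V"]) auto
  show ?case
  proof (cases "\<forall>v\<in>V. c \<le> card (incident E v)")
    case True
    have "card (incident E v) \<le> card {u \<in> V. {v, u} \<in> E}" for v
    proof -
      have "incident E v \<subseteq> (\<lambda>u. {v, u}) ` {u \<in> V. {v, u} \<in> E}"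
      proof
        fix e assume "e \<in> incident E v"
        then have e: "e \<in> E" "v \<in> e" by (auto simp: incident_def)
        then obtain u where "e = {v, u}" using edge_other_endpoint less.prems(3) by metis
        then show "e \<in> (\<lambda>u. {v, u}) ` {u \<in> V. {v, u} \<in> E}" using e less.prems(3) by auto
      qed
      then have "card (incident E v) \<le> card ((\<lambda>u. {v, u}) ` {u \<in> V. {v, u} \<in> E})"
        using less.prems(1) by (intro card_mono) auto
      also have "\<dots> \<le> card {u \<in> V. {v, u} \<in> E}" using less.prems(1) by (intro card_image_le) auto
      finally show ?thesis .
    qed
    then show ?thesis using True less.prems(2) by (intro exI[of _ V]) (meson le_trans order_refl)
  next
    case False
    then obtain v where v: "v \<in> V" "card (incident E v) < c" by force
    have ne: "V - {v} \<noteq> {}"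
    proof
      assume "V - {v} = {}"
      then have V: "V = {v}" using v by blast
      then have "e = {} \<or> e = {v}" if "e \<in> E" for e using less.prems(3) that by blast
      then have "E = {}" using less.prems(3) by fastforce
      then show False using less.prems(4) V v by simp
    qed
    have sub: "incident E v \<subseteq> E" by (auto simp: incident_def)
    have "card (V - {v}) = card V - 1" "card V > 0" using v less.prems(1) by (auto simp: card_gt_0_iff)
    moreover have "card (E - incident E v) = card E - card (incident E v)"
      using finE sub by (intro card_Diff_subset finite_incident)
    ultimately have le: "c * card (V - {v}) \<le> card (E - incident E v)"
      using less.prems(4) v(2) by (simp add: diff_mult_distrib2)
    have "\<forall>e\<in>E - incident E v. e \<subseteq> V - {v} \<and> card e = 2"
      using less.prems(3) by (auto simp: incident_def)
    from less.hyps[OF card_Diff1_less[OF less.prems(1) v(1)] finite_Diff[OF less.prems(1)] ne this le]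
    obtain W where W: "W \<subseteq> V - {v}" "W \<noteq> {}"
      "\<forall>w\<in>W. c \<le> card {u \<in> W. {w, u} \<in> E - incident E v}"
      by (elim exE conjE)
    have "c \<le> card {u \<in> W. {w, u} \<in> E}" if "w \<in> W" for w
    proof (rule order_trans)
      show "c \<le> card {u \<in> W. {w, u} \<in> E - incident E v}" using W(3) that by blast
      show "card {u \<in> W. {w, u} \<in> E - incident E v} \<le> card {u \<in> W. {w, u} \<in> E}"
        using finite_subset[OF W(1)] less.prems(1) by (intro card_mono) auto
    qed
    then show ?thesis using W(1,2) by blast
  qed
qed

text \<open>Greedy embedding with a leaf placed last: fewer than \<open>c\<close> vertices are
  occupied by then, so the image of its neighbour still has a free neighbour in
  \<open>W\<close>.\<close>

lemma forest_embeds_min_degree: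
  assumes "forest F" "finite W" "W \<noteq> {}" "card (verts F) \<le> c"
    and "\<forall>w\<in>W. c \<le> card {u \<in> W. {w, u} \<in> E}"
  shows "\<exists>\<phi>. inj_on \<phi> (verts F) \<and> \<phi> ` verts F \<subseteq> W \<and> (`) \<phi> ` edges F \<subseteq> E"
  using assms(1,4)
proof (induction "card (verts F)" arbitrary: F rule: less_induct)
  case less
  have fF: "fin_simple_graph F" using less.prems(1) by (simp add: forest_def)
  show ?case
  proof (cases "verts F = {}")
    case True
    then have "edges F = {}" using fF by (fastforce simp: fin_simple_graph_def)
    then show ?thesis using True by simp
  next
    case False
    then obtain v where v: "v \<in> verts F" "card (incident (edges F) v) \<le> 1"
      using forest_ex_leaf[OF less.prems(1)] by blast
    let ?F = "(verts F - {v}, edges F - incident (edges F) v)"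
    have finV: "finite (verts F)" using fF by (simp add: fin_simple_graph_def)
    have card: "card (verts ?F) < card (verts F)"
      using v(1) finV card_Diff1_less[of "verts F" v] by simp
    then have "card (verts ?F) \<le> c" using less.prems(2) by simp
    from less.hyps[OF card forest_delete_vertex[OF less.prems(1)] this]
    obtain \<phi> where \<phi>: "inj_on \<phi> (verts F - {v})" "\<phi> ` (verts F - {v}) \<subseteq> W"
      "(`) \<phi> ` (edges F - incident (edges F) v) \<subseteq> E" by auto
    have "card (\<phi> ` (verts F - {v})) < c"
      using card_image_le[of "verts F - {v}" \<phi>] finV card less.prems(2) by simp
    then have new: "\<exists>x\<in>S. x \<notin> \<phi> ` (verts F - {v})" if "c \<le> card S" for S
      using that card_mono[of "\<phi> ` (verts F - {v})" S] finV by fastforce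
    have "\<exists>x\<in>W. x \<notin> \<phi> ` (verts F - {v}) \<and> (\<forall>u. {v, u} \<in> edges F \<longrightarrow> {x, \<phi> u} \<in> E)"
    proof (cases "\<exists>u. {v, u} \<in> edges F")
      case True
      then obtain u where u: "{v, u} \<in> edges F" by blast
      have "u' = u" if "{v, u'} \<in> edges F" for u'
      proof -
        have "{v, u} \<in> incident (edges F) v" "{v, u'} \<in> incident (edges F) v"
          using u that by (auto simp: incident_def)
        then have "{v, u'} = {v, u}"
          using v(2) finite_edges[OF fF] by (auto simp: card_le_Suc0_iff_eq)
        then show ?thesis by (auto simp: doubleton_eq_iff)
      qed
      moreover have "u \<noteq> v" "u \<in> verts F" using fin_simple_graph_edgeD[OF fF u] by auto
      then have "\<phi> u \<in> W" using \<phi>(2) by auto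
      then obtain x where "x \<in> W" "{\<phi> u, x} \<in> E" "x \<notin> \<phi> ` (verts F - {v})"
        using new assms(5) by blast
      ultimately show ?thesis by (metis insert_commute)
    next
      case False
      obtain w where "w \<in> W" using assms(3) by blast
      moreover have "card {u \<in> W. {w, u} \<in> E} \<le> card W" using assms(2) by (intro card_mono) auto
      ultimately have "c \<le> card W" using assms(5) le_trans by blast
      then show ?thesis using new False by blast
    qed
    then obtain x where x: "x \<in> W" "x \<notin> \<phi> ` (verts F - {v})" "\<And>u. {v, u} \<in> edges F \<Longrightarrow> {x, \<phi> u} \<in> E"
      by blast
    let ?\<phi> = "\<phi>(v := x)"
    have "inj_on ?\<phi> (verts F)" using \<phi>(1) x(2) v(1) by (auto simp: inj_on_def)
    moreover have "?\<phi> ` verts F \<subseteq> W" using \<phi>(2) x(1) by auto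
    moreover have "?\<phi> ` e \<in> E" if e: "e \<in> edges F" for e
    proof (cases "v \<in> e")
      case True
      obtain u where u: "e = {v, u}" "u \<noteq> v"
        using edge_other_endpoint[OF fin_simple_graph_edgeD(2)[OF fF e] True] .
      then show ?thesis using x(3) e by (auto simp: insert_commute)
    next
      case False
      then have "?\<phi> ` e = \<phi> ` e" by (intro image_cong) auto
      then show ?thesis using \<phi>(3) False e by (auto simp: incident_def)
    qed
    ultimately show ?thesis by (intro exI[of _ ?\<phi>]) auto
  qed
qed

section \<open>Graphs of large girth\<close>

lemma sum_degrees:
  assumes "finite V" "\<forall>e\<in>E. e \<subseteq> V \<and> card e = 2"
  shows "(\<Sum>v\<in>V. card (incident E v)) = 2 * card E"
proof -
  have finE: "finite E" using assms by (intro finite_subset[of E "Pow V"]) auto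
  have "(\<Sum>v\<in>V. card (incident E v)) = (\<Sum>v\<in>V. \<Sum>e\<in>E. if v \<in> e then 1 else 0)"
    using finE by (simp add: incident_def sum.If_cases Int_def)
  also have "\<dots> = (\<Sum>e\<in>E. \<Sum>v\<in>V. if v \<in> e then 1 else 0)" by (rule sum.swap)
  also have "\<dots> = (\<Sum>e\<in>E. card e)"
    using assms by (intro sum.cong refl) (simp add: sum.If_cases Int_absorb1)
  also have "\<dots> = 2 * card E" using assms(2) by simp
  finally show ?thesis .
qed

definition adj :: "'a set set \<Rightarrow> ('a \<times> 'a) set" where
  "adj E = {(x, y). {x, y} \<in> E \<and> x \<noteq> y}"

lemma relpow_adj_sym: "(x, y) \<in> adj E ^^ m \<Longrightarrow> (y, x) \<in> adj E ^^ m"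
proof (induction m arbitrary: y)
  case (Suc m)
  then obtain z where "(x, z) \<in> adj E ^^ m" "(z, y) \<in> adj E" by auto
  then show ?case using Suc.IH relpow_Suc_I2[of y z "adj E" x m]
    by (auto simp: adj_def insert_commute)
qed simp

lemma card_relpow_adj:
  assumes "finite E" "\<And>v. card (incident E v) \<le> d"
  shows "finite ((adj E ^^ m) `` {u}) \<and> card ((adj E ^^ m) `` {u}) \<le> d ^ m"
proof (induction m)
  case (Suc m)
  let ?S = "(adj E ^^ m) `` {u}"
  have nbrs: "finite (adj E `` {w}) \<and> card (adj E `` {w}) \<le> d" for w
  proof -
    have inj: "inj_on (\<lambda>x. {w, x}) (adj E `` {w})" by (auto simp: inj_on_def doubleton_eq_iff)
    have sub: "(\<lambda>x. {w, x}) ` (adj E `` {w}) \<subseteq> incident E w" by (auto simp: adj_def incident_def)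
    have "finite (adj E `` {w})"
      using finite_imageD[OF finite_subset[OF sub] inj] assms(1) by simp
    moreover have "card (adj E `` {w}) \<le> card (incident E w)"
      using card_inj_on_le[OF inj sub] assms(1) by simp
    ultimately show ?thesis using assms(2)[of w] by simp
  qed
  have eq: "(adj E ^^ Suc m) `` {u} = (\<Union>w\<in>?S. adj E `` {w})" by auto
  have "card (\<Union>w\<in>?S. adj E `` {w}) \<le> (\<Sum>w\<in>?S. card (adj E `` {w}))"
    using Suc.IH by (intro card_UN_le) simp
  also have "\<dots> \<le> (\<Sum>w\<in>?S. d)" using nbrs by (intro sum_mono) simp
  also have "\<dots> \<le> d ^ Suc m" using Suc.IH by simp
  finally show ?case unfolding eq using Suc.IH nbrs by blast
qed simp

text \<open>A short cycle created by a new edge \<open>{u, v}\<close> leaves a short walk between \<open>u\<close> and \<open>v\<close>.\<close>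

lemma cycle_new_edge:
  assumes "is_cycle (V, insert {u, v} E) vs" "\<not> is_cycle (V, E) vs"
  shows "(u, v) \<in> adj E ^^ (length vs - 1)"
proof -
  define l where "l = length vs"
  have vs: "3 \<le> l" "distinct vs" "\<And>i. i < l \<Longrightarrow> {vs ! i, vs ! (Suc i mod l)} \<in> insert {u, v} E"
    using assms(1) by (auto simp: is_cycle_def l_def)
  obtain i where i: "i < l" "{vs ! i, vs ! (Suc i mod l)} \<notin> E"
    using assms vs by (auto simp: is_cycle_def l_def)
  then have uv: "{vs ! i, vs ! (Suc i mod l)} = {u, v}" using vs(3) by blast
  \<comment> \<open>The walk goes round the cycle from one end of the new edge to the other.\<close>
  define w where "w j = vs ! ((Suc i + j) mod l)" for j
  have nth_eq: "vs ! (a mod l) = vs ! (b mod l) \<longleftrightarrow> a mod l = b mod l" for a b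
    using nth_eq_iff_index_eq[OF vs(2), of "a mod l" "b mod l"]
      mod_less_divisor[of l a] mod_less_divisor[of l b] vs(1) unfolding l_def by linarith
  have step: "(w j, w (Suc j)) \<in> adj E" if "j < l - 1" for j
  proof -
    let ?k = "(Suc i + j) mod l"
    have k: "?k < l" "Suc ?k mod l = (Suc i + Suc j) mod l" using vs(1) by (simp_all add: mod_Suc_eq)
    have ne: "(Suc i + j) mod l \<noteq> (Suc i + Suc j) mod l"
      using vs(1) mod_eq_dvd_iff_nat[of "Suc i + j" "Suc i + Suc j" l] by auto
    have "(Suc i + j) mod l \<noteq> i mod l"
    proof
      assume "(Suc i + j) mod l = i mod l"
      then have "l dvd Suc j" using mod_eq_dvd_iff_nat[of i "Suc i + j" l] by simp
      then show False using that by (auto dest: dvd_imp_le)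
    qed
    \<comment> \<open>Meeting the new edge backwards would force \<open>j = 0\<close> and a cycle of
      length 2; this is where cycles having length at least 3 matters.\<close>
    moreover have "\<not> ((Suc i + j) mod l = Suc i mod l \<and> (Suc i + Suc j) mod l = i mod l)"
    proof
      assume *: "(Suc i + j) mod l = Suc i mod l \<and> (Suc i + Suc j) mod l = i mod l"
      then have "l dvd j" using mod_eq_dvd_iff_nat[of "Suc i" "Suc i + j" l] by simp
      then have "j = 0" using that by (auto dest: dvd_imp_le)
      then have "l dvd 2" using * mod_eq_dvd_iff_nat[of i "Suc i + Suc j" l] by simp
      then show False using vs(1) by (auto dest: dvd_imp_le)
    qed
    ultimately have "{w j, w (Suc j)} \<noteq> {vs ! (i mod l), vs ! (Suc i mod l)}"
      by (auto simp: w_def doubleton_eq_iff nth_eq)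
    then have "{w j, w (Suc j)} \<noteq> {u, v}" using uv i(1) by simp
    moreover have "{w j, w (Suc j)} \<in> insert {u, v} E" using vs(3)[OF k(1)] k(2) by (simp add: w_def)
    moreover have "w j \<noteq> w (Suc j)" using ne by (simp only: w_def nth_eq not_False_eq_True)
    ultimately show ?thesis by (simp add: adj_def)
  qed
  have "(w 0, w j) \<in> adj E ^^ j" if "j \<le> l - 1" for j
    using that
  proof (induction j)
    case (Suc j)
    then show ?case using step[of j] by auto
  qed simp
  from this[of "l - 1"] have "(w 0, w (l - 1)) \<in> adj E ^^ (l - 1)" by simp
  moreover have "w 0 = vs ! (Suc i mod l)" "w (l - 1) = vs ! i"
    using vs(1) i(1) by (simp_all add: w_def)
  ultimately show ?thesis using uv relpow_adj_sym by (fastforce simp: l_def doubleton_eq_iff)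
qed

text \<open>In an edge-maximal graph of maximum degree at most \<open>d\<close> and girth greater than \<open>g\<close>, the vertices of
  degree less than \<open>d\<close> have bounded pairwise distance, so they are few (Erdos and Sachs).\<close>

lemma ex_large_girth_graph:
  "\<exists>G :: nat graph. fin_simple_graph G \<and> verts G \<noteq> {} \<and> 3 * c * card (verts G) \<le> card (edges G) \<and>
     (\<forall>vs. is_cycle G vs \<longrightarrow> g < length vs)"
proof -
  \<comment> \<open>At least \<open>C\<close> of the \<open>2 * C\<close> vertices will have degree
    \<open>d\<close>, so \<open>2 * card E \<ge> 12 * c * C\<close>, that is,
    \<open>card E \<ge> 3 * c * card V\<close>.\<close>
  define d where "d = 12 * c"
  \<comment> \<open>This bounds a ball of radius \<open>Suc g\<close>. A blocked edge has ends at
    distance below \<open>g\<close>; the larger radius covers adjacent vertices even for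
    \<open>g = 0\<close>.\<close>
  define C where "C = (\<Sum>m\<le>Suc g. d ^ m)"
  have "C \<ge> d ^ 0" unfolding C_def by (rule member_le_sum) auto
  then have C: "C > 0" by simp
  define V where "V = {..<2 * C}"
  define P where "P E \<longleftrightarrow> (\<forall>e\<in>E. e \<subseteq> V \<and> card e = 2) \<and> (\<forall>v. card (incident E v) \<le> d) \<and>
    (\<forall>vs. is_cycle (V, E) vs \<longrightarrow> g < length vs)" for E
  have "P {}" by (auto simp: P_def incident_def is_cycle_def intro!: exI[of _ 0])
  then have "{E. P E} \<noteq> {}" by blast
  moreover have "{E. P E} \<subseteq> Pow (Pow V)" by (auto simp: P_def)
  then have "finite {E. P E}" by (rule finite_subset) (simp add: V_def)
  ultimately obtain E where "E \<in> {E. P E}" and E_max: "\<forall>E'\<in>{E. P E}. E \<subseteq> E' \<longrightarrow> E = E'"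
    using finite_has_maximal[of "{E. P E}"] by blast
  then have E: "\<forall>e\<in>E. e \<subseteq> V \<and> card e = 2" "\<And>v. card (incident E v) \<le> d"
    "\<And>vs. is_cycle (V, E) vs \<Longrightarrow> g < length vs"
    by (auto simp: P_def)
  have finV: "finite V" by (simp add: V_def)
  have finE: "finite E" using E(1) finV by (intro finite_subset[of E "Pow V"]) auto
  define L where "L = {v \<in> V. card (incident E v) < d}"
  have near: "\<exists>m\<le>Suc g. (u, v) \<in> adj E ^^ m" if uv: "u \<in> L" "v \<in> L" for u v
  proof (cases "u = v \<or> {u, v} \<in> E")
    case True
    show ?thesis
    proof (cases "u = v")
      case False
      then have "(u, v) \<in> adj E ^^ 1" using True by (simp add: adj_def)
      then show ?thesis by (intro exI[of _ 1]) simp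
    qed (auto intro!: exI[of _ 0])
  next
    case False
    let ?E = "insert {u, v} E"
    have "card (incident ?E w) \<le> d" for w
    proof (cases "w \<in> {u, v}")
      case True
      then have "incident ?E w = insert {u, v} (incident E w)" by (auto simp: incident_def)
      moreover have "card (incident E w) < d" using uv True by (auto simp: L_def)
      ultimately show ?thesis using finE by (simp add: card_insert_if)
    next
      case False
      then have "incident ?E w = incident E w" by (auto simp: incident_def)
      then show ?thesis using E(2) by simp
    qed
    moreover have "\<forall>e\<in>?E. e \<subseteq> V \<and> card e = 2" using E(1) uv False by (auto simp: L_def)
    moreover have "\<not> P ?E" using E_max False by auto
    ultimately obtain vs where vs: "is_cycle (V, ?E) vs" "length vs \<le> g"
      unfolding P_def by (meson not_less)
    then have "\<not> is_cycle (V, E) vs" using E(3) by fastforce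
    from cycle_new_edge[OF vs(1) this] show ?thesis using vs(2) by (intro exI[of _ "length vs - 1"]) simp
  qed
  have cL: "card L \<le> C"
  proof (cases "L = {}")
    case False
    then obtain u where u: "u \<in> L" by blast
    have fin: "finite ((adj E ^^ m) `` {u})" and le: "card ((adj E ^^ m) `` {u}) \<le> d ^ m" for m
      using card_relpow_adj[OF finE E(2)] by auto
    have "L \<subseteq> (\<Union>m\<le>Suc g. (adj E ^^ m) `` {u})" using near[OF u] by blast
    then have "card L \<le> card (\<Union>m\<le>Suc g. (adj E ^^ m) `` {u})"
      using fin by (intro card_mono) auto
    also have "\<dots> \<le> (\<Sum>m\<le>Suc g. card ((adj E ^^ m) `` {u}))" by (intro card_UN_le) simp
    also have "\<dots> \<le> C" unfolding C_def by (intro sum_mono le)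
    finally show ?thesis .
  qed simp
  have L: "L \<subseteq> V" by (auto simp: L_def)
  have "C * d \<le> (card V - card L) * d" using cL by (intro mult_right_mono) (auto simp: V_def)
  also have "\<dots> = (\<Sum>v\<in>V - L. d)"
    using L finV by (simp add: card_Diff_subset[OF finite_subset[OF L finV] L])
  also have "\<dots> \<le> (\<Sum>v\<in>V - L. card (incident E v))" by (rule sum_mono) (auto simp: L_def)
  also have "\<dots> \<le> (\<Sum>v\<in>V. card (incident E v))" using finV by (intro sum_mono2) auto
  also have "\<dots> = 2 * card E" by (rule sum_degrees[OF finV E(1)])
  finally have "3 * c * card V \<le> card E" by (simp add: V_def d_def mult.commute)
  moreover have "fin_simple_graph (V, E)" using E(1) finV by (simp add: fin_simple_graph_def)
  moreover have "0 \<in> V" using C by (simp add: V_def)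
  then have "V \<noteq> {}" by blast
  ultimately show ?thesis using E(3) by (intro exI[of _ "(V, E)"]) auto
qed

section \<open>Forests having an edge with both ends of degree at least 2\<close>

lemma cycle_length_le_card_edges:
  assumes "is_cycle G vs" "finite (edges G)"
  shows "length vs \<le> card (edges G)"
proof -
  let ?l = "length vs"
  let ?h = "\<lambda>i. {vs ! i, vs ! (Suc i mod ?l)}"
  have vs: "3 \<le> ?l" "distinct vs" "?h ` {..<?l} \<subseteq> edges G" using assms(1) by (auto simp: is_cycle_def)
  have "inj_on ?h {..<?l}"
  proof (rule inj_onI)
    fix i j assume ij: "i \<in> {..<?l}" "j \<in> {..<?l}" "?h i = ?h j"
    have lt: "Suc a mod ?l < ?l" for a using vs(1) by (intro mod_less_divisor) linarith
    consider "i = j" | "i = Suc j mod ?l" "Suc i mod ?l = j"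
      using ij lt[of i] lt[of j] vs(2) by (auto simp: doubleton_eq_iff nth_eq_iff_index_eq)
    then show "i = j"
    proof cases
      case 2
      then have "Suc (Suc j) mod ?l = j mod ?l" using ij(2) by (auto simp: mod_Suc_eq)
      then have "?l dvd 2" using mod_eq_dvd_iff_nat[of j "Suc (Suc j)" ?l] by simp
      then show ?thesis using vs(1) by (auto dest: dvd_imp_le)
    qed
  qed
  then have "card {..<?l} \<le> card (edges G)" using vs(3) assms(2) by (rule card_inj_on_le)
  then show ?thesis by simp
qed

text \<open>Mapping each edge of a forest to its parent edge hits every copy of \<open>F\<close>, since of three
  consecutive edges two form a parent-child pair.\<close>

lemma forest_not_unavoidable:
  assumes "fin_simple_graph F" "{b, c} \<in> edges F"
    and "2 \<le> card (incident (edges F) b)" "2 \<le> card (incident (edges F) c)"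
    and "forest H"
  shows "\<not> unavoidable F H"
proof -
  obtain own where own: "\<forall>e\<in>edges H. own e \<in> e"
    "\<forall>v. \<forall>e\<in>edges H. \<forall>e'\<in>edges H. v \<in> e \<longrightarrow> v \<in> e' \<longrightarrow> own e \<noteq> v \<longrightarrow> own e' \<noteq> v \<longrightarrow> e = e'"
    using forest_owner[OF assms(5)] by blast
  \<comment> \<open>The parent edge of \<open>e\<close> is the edge at its tail that the tail does
    not own. At a root there is none and the value is arbitrary, which
    \<open>not_unavoidableI\<close> tolerates.\<close>
  define g where "g e = (SOME e'. e' \<in> edges H \<and> own e \<in> e' \<and> own e' \<noteq> own e)" for e
  have g: "g e' = e" if "e \<in> edges H" "e' \<in> edges H" "e \<noteq> e'" "v \<in> e" "v \<in> e'" "own e \<noteq> v" for e e' v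
  proof -
    have v: "own e' = v" using own(2) that by blast
    show ?thesis unfolding g_def v
    proof (rule some_equality)
      fix e'' assume "e'' \<in> edges H \<and> v \<in> e'' \<and> own e'' \<noteq> v"
      then show "e'' = e" using own(2) that by blast
    qed (use that in auto)
  qed
  have bc: "b \<noteq> c" using fin_simple_graph_edgeD(2)[OF assms(1,2)] by (auto simp: card_2_iff)
  have other: "\<exists>e\<in>edges F. v \<in> e \<and> e \<noteq> {b, c}" if deg: "2 \<le> card (incident (edges F) v)" for v
  proof (rule ccontr)
    assume "\<not> ?thesis"
    then have "incident (edges F) v \<subseteq> {{b, c}}" by (auto simp: incident_def)
    from card_mono[OF _ this] show False using deg by simp
  qed
  obtain e1 where e1: "e1 \<in> edges F" "b \<in> e1" "e1 \<noteq> {b, c}" using other[OF assms(3)] by blast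
  obtain e3 where e3: "e3 \<in> edges F" "c \<in> e3" "e3 \<noteq> {b, c}" using other[OF assms(4)] by blast
  show ?thesis
  proof (rule not_unavoidableI[where g = g])
    have "card {e1, {b, c}} \<le> card (edges F)"
      using e1 assms(2) finite_edges[OF assms(1)] by (intro card_mono) auto
    then show "2 \<le> card (edges F)" using e1(3) by simp
  next
    fix G' assume copy: "copy_in F H G'"
    obtain \<phi> where \<phi>: "inj_on \<phi> (verts F)" "edges G' = (`) \<phi> ` edges F" "edges G' \<subseteq> edges H"
      using copy by (elim copy_inE) (auto simp: subgraph_def)
    have inj: "inj_on ((`) \<phi>) (edges F)" by (rule inj_on_image_edges[OF assms(1) \<phi>(1)])
    let ?e2 = "\<phi> ` {b, c}"
    have mem: "\<phi> ` e \<in> edges G'" "\<phi> ` e \<in> edges H" if "e \<in> edges F" for e using that \<phi>(2,3) by auto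
    have ne: "?e2 \<noteq> \<phi> ` e1" "?e2 \<noteq> \<phi> ` e3"
      using inj_on_eq_iff[OF inj assms(2) e1(1)] inj_on_eq_iff[OF inj assms(2) e3(1)] e1(3) e3(3)
      by metis+
    have "\<phi> b \<noteq> \<phi> c"
      using bc \<phi>(1) fin_simple_graph_edgeD(1)[OF assms(1,2)] by (auto dest: inj_onD)
    \<comment> \<open>The middle edge has a single owner. At an end that does not own it, it is the
      parent of the outer edge there.\<close>
    then consider "own ?e2 \<noteq> \<phi> b" | "own ?e2 \<noteq> \<phi> c" by metis
    then show "\<exists>e\<in>edges G'. g e \<in> edges G' \<and> g e \<noteq> e"
    proof cases
      case 1
      then have "g (\<phi> ` e1) = ?e2"
        using e1(2) by (intro g[OF mem(2)[OF assms(2)] mem(2)[OF e1(1)] ne(1) _ _ 1]) auto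
      then show ?thesis using mem(1)[OF e1(1)] mem(1)[OF assms(2)] ne by metis
    next
      case 2
      then have "g (\<phi> ` e3) = ?e2"
        using e3(2) by (intro g[OF mem(2)[OF assms(2)] mem(2)[OF e3(1)] ne(2) _ _ 2]) auto
      then show ?thesis using mem(1)[OF e3(1)] mem(1)[OF assms(2)] ne by metis
    qed
  qed
qed

text \<open>The factor 3 pays for an \<open>f\<close>-free third of the edges. The remaining
  \<open>card (verts F)\<close> edges per vertex yield a subgraph of minimum degree
  \<open>card (verts F)\<close>, in which \<open>F\<close> embeds greedily.\<close>

lemma unavoidable_dense:
  assumes "forest F" "no_isolated_verts F" "fin_simple_graph G" "verts G \<noteq> {}"
    and "3 * card (verts F) * card (verts G) \<le> card (edges G)"
  shows "unavoidable F G"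
proof (rule unavoidableI)
  show fF: "fin_simple_graph F" using assms(1) by (simp add: forest_def)
  fix f assume f: "\<forall>e\<in>edges G. f e \<noteq> e"
  have "card ({f e} \<inter> edges G) \<le> 1" for e by (rule order_trans[OF card_mono[of "{f e}"]]) auto
  then obtain I where I: "I \<subseteq> edges G" "card I = card (verts F) * card (verts G)"
    "\<forall>x\<in>I. \<forall>y\<in>I. y \<in> {f x} \<longrightarrow> y = x"
    using independent_subset[OF finite_edges[OF assms(3)], of "\<lambda>e. {f e}" 1 "card (verts F) * card (verts G)"]
      assms(5) by (auto simp: mult_ac)
  have finV: "finite (verts G)" using assms(3) by (simp add: fin_simple_graph_def)
  obtain W where W: "W \<subseteq> verts G" "W \<noteq> {}" "\<forall>w\<in>W. card (verts F) \<le> card {u \<in> W. {w, u} \<in> I}"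
    using ex_min_degree_subset[OF finV assms(4), of I "card (verts F)"] I(1,2) assms(3)
    by (auto simp: fin_simple_graph_def)
  obtain \<phi> where \<phi>: "inj_on \<phi> (verts F)" "(`) \<phi> ` edges F \<subseteq> I"
    using forest_embeds_min_degree[OF assms(1) finite_subset[OF W(1) finV] W(2) order_refl W(3)] by blast
  have "f (\<phi> ` e) \<notin> (`) \<phi> ` edges F" if e: "e \<in> edges F" for e
  proof
    assume "f (\<phi> ` e) \<in> (`) \<phi> ` edges F"
    then have "f (\<phi> ` e) \<in> I" "\<phi> ` e \<in> I" using \<phi>(2) e by auto
    moreover from this have "f (\<phi> ` e) = \<phi> ` e" using I(3) by simp
    ultimately show False using f I(1) by auto
  qed
  then show "\<exists>\<phi>. inj_on \<phi> (verts F) \<and> (`) \<phi> ` edges F \<subseteq> edges G \<and>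
    (\<forall>e\<in>edges F. f (\<phi> ` e) \<notin> (`) \<phi> ` edges F)"
    using \<phi> I(1) by (intro exI[of _ \<phi>]) auto
qed (use assms in auto)

text \<open>An unavoidable subgraph of a graph of girth above \<open>n\<close> contains a cycle, and
  this cycle alone has more than \<open>n\<close> edges.\<close>

lemma infinite_min_unavoidables_non_star:
  assumes "forest F" "no_isolated_verts F" "{b, c} \<in> edges F"
    and "2 \<le> card (incident (edges F) b)" "2 \<le> card (incident (edges F) c)"
  shows "infinite (min_unavoidables F)"
proof (rule infinite_min_unavoidables)
  fix n
  have fF: "fin_simple_graph F" using assms(1) by (simp add: forest_def)
  obtain G :: "nat graph" where G: "fin_simple_graph G" "verts G \<noteq> {}"
    "3 * card (verts F) * card (verts G) \<le> card (edges G)" "\<forall>vs. is_cycle G vs \<longrightarrow> n < length vs"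
    using ex_large_girth_graph[of "card (verts F)" n] by blast
  have "n \<le> card (edges G')" if sub: "subgraph G' G" and un: "unavoidable F G'" for G'
  proof -
    have fG': "fin_simple_graph G'" using sub by (simp add: subgraph_def)
    have "\<not> forest G'" using forest_not_unavoidable[OF fF assms(3-5)] un by blast
    then obtain vs where vs: "is_cycle G' vs" using fG' by (auto simp: forest_def)
    then have "is_cycle G vs" using sub by (auto simp: is_cycle_def subgraph_def)
    then have "n < length vs" using G(4) by blast
    also have "\<dots> \<le> card (edges G')" by (rule cycle_length_le_card_edges[OF vs finite_edges[OF fG']])
    finally show ?thesis by simp
  qed
  then show "\<exists>G :: nat graph. unavoidable F G \<and>
    (\<forall>G'. subgraph G' G \<and> unavoidable F G' \<longrightarrow> n \<le> card (edges G'))"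
    using unavoidable_dense[OF assms(1,2) G(1-3)] by blast
qed

section \<open>Star forests\<close>

text \<open>\<open>X\<close> is partitioned into \<open>m\<close> cells of at most 3 elements, any two of which are related by \<open>h\<close>; the
  element outside \<open>A\<close> has no image under \<open>h\<close> and shares its cell with at most one other element. A fixed
  point of \<open>h\<close> stands for an undefined value.\<close>

lemma no_large_independent_set:
  assumes "finite X" "A \<subseteq> X" "card (X - A) \<le> 1" "card X + card (X - A) \<le> 3 * m"
  shows "\<exists>h. \<forall>I\<subseteq>X. (\<forall>e\<in>I \<inter> A. h e \<in> I \<longrightarrow> h e = e) \<longrightarrow> card I \<le> m"
  using assms
proof (induction m arbitrary: X A)
  case 0
  then have "X = {}" by simp
  then show ?case by auto
next
  case (Suc m)
  \<comment> \<open>\<open>Q\<close> is one cell and \<open>k\<close> the map on it: any two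
    elements are related, so an independent set meets \<open>Q\<close> at most once.
    \<open>card\<close> is the budget for the other \<open>m\<close> cells.\<close>
  have step: ?case if Q: "Q \<subseteq> X" "\<And>x y. x \<in> Q \<Longrightarrow> y \<in> Q \<Longrightarrow> x \<noteq> y \<Longrightarrow> x \<in> A \<and> k x = y \<or> y \<in> A \<and> k y = x"
    and card: "card (X - Q) + card (X - A - Q) \<le> 3 * m" for Q k
  proof -
    have eq: "X - Q - (A - Q) = X - A - Q" by blast
    have "card (X - A - Q) \<le> card (X - A)" using Suc.prems(1) by (intro card_mono) auto
    then obtain h where h: "\<And>I. I \<subseteq> X - Q \<Longrightarrow> \<forall>e\<in>I \<inter> (A - Q). h e \<in> I \<longrightarrow> h e = e \<Longrightarrow> card I \<le> m"
      using Suc.IH[of "X - Q" "A - Q"] Suc.prems card eq by auto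
    have bound: "card I \<le> Suc m" if I: "I \<subseteq> X" "\<forall>e\<in>I \<inter> A. (if e \<in> Q then k e else h e) \<in> I \<longrightarrow>
        (if e \<in> Q then k e else h e) = e" for I
    proof -
      have finI: "finite I" using I(1) Suc.prems(1) finite_subset by blast
      have "h e = e" if "e \<in> (I - Q) \<inter> (A - Q)" "h e \<in> I - Q" for e
        using bspec[OF I(2), of e] that by simp
      then have "card (I - Q) \<le> m" using I(1) by (intro h) auto
      moreover have "x = y" if xy: "x \<in> I \<inter> Q" "y \<in> I \<inter> Q" for x y
        using Q(2)[of x y] bspec[OF I(2), of x] bspec[OF I(2), of y] xy
        by (cases "x = y") auto
      then have "card (I \<inter> Q) \<le> 1" using finI by (auto simp: card_le_Suc0_iff_eq)
      moreover have "card I = card (I - Q) + card (I \<inter> Q)"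
        using card_Int_Diff[OF finI, of Q] by simp
      ultimately show ?thesis by simp
    qed
    show ?thesis by (intro exI[of _ "\<lambda>e. if e \<in> Q then k e else h e"] allI impI) (rule bound)
  qed
  have pair: ?case if cp: "c \<in> A" "p \<in> X" "c \<noteq> p" "card (X - {c, p}) + card (X - A - {c, p}) \<le> 3 * m" for c p
    by (rule step[of "{c, p}" "\<lambda>_. p"]) (use cp Suc.prems(2) in auto)
  show ?case
  proof (cases "card X \<le> 1")
    case True
    then have "card I \<le> Suc m" if "I \<subseteq> X" for I using card_mono[OF Suc.prems(1) that] by linarith
    then show ?thesis by blast
  next
    case False
    show ?thesis
    proof (cases "X = A")
      case True
      obtain x where x: "x \<in> X" using False by fastforce
      have "card (X - {x}) \<ge> 1" using False x Suc.prems(1) by simp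
      then have "X - {x} \<noteq> {}" by (metis card.empty not_one_le_zero)
      then obtain y where y: "y \<in> X" "y \<noteq> x" by blast
      have c2: "card (X - {x, y}) = card X - 2"
        using x y Suc.prems(1) by (subst card_Diff_subset) auto
      show ?thesis
      proof (cases "card X = 2")
        case True
        then show ?thesis using x y c2 \<open>X = A\<close> by (intro pair[of x y]) auto
      next
        case F: False
        then have "card (X - {x, y}) > 0" using False c2 by simp
        then have "X - {x, y} \<noteq> {}" by (metis card.empty less_irrefl)
        then obtain z where z: "z \<in> X" "z \<noteq> x" "z \<noteq> y" by blast
        have "card (X - {x, y, z}) = card X - 3"
          using x y z Suc.prems(1) by (subst card_Diff_subset) auto
        then show ?thesis using x y z \<open>X = A\<close> Suc.prems(4)
          by (intro step[of "{x, y, z}" "\<lambda>a. if a = x then y else if a = y then z else x"]) auto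
      qed
    next
      case XA: False
      \<comment> \<open>Cell mates of \<open>p\<close> must all be sent to \<open>p\<close>, so two
        of them would be unrelated. Hence the cell of \<open>p\<close> is a pair, and the summand
        \<open>card (X - A)\<close> pays for its empty third place.\<close>
      then obtain p where p: "p \<in> X - A" using Suc.prems(2) by blast
      have "X - A \<subseteq> {p}"
        using Suc.prems(1,3) p by (auto simp: card_le_Suc0_iff_eq)
      then have XAp: "X - A = {p}" using p by blast
      have "card (X - {p}) \<ge> 1" using False p Suc.prems(1) by simp
      then have "X - {p} \<noteq> {}" by (metis card.empty not_one_le_zero)
      then obtain c where c: "c \<in> X" "c \<noteq> p" by blast
      have "card (X - {c, p}) = card X - 2"
        using p c Suc.prems(1) by (subst card_Diff_subset) auto
      then show ?thesis using c p XAp Suc.prems(4) by (intro pair[of c p]) auto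
    qed
  qed
qed

text \<open>Without such a star, Turan forces at least
  \<open>2 * card (incident E v) - 3 * m\<close> arcs at each \<open>v\<close>. Sets of arcs at
  different vertices are disjoint, so their total is at most \<open>card E\<close>.\<close>

lemma ex_free_star:
  assumes "finite E" "\<forall>e\<in>E. card e = 2" "finite W" "\<forall>e\<in>E. f e \<noteq> e"
    and "3 * m * card W + card E < (\<Sum>v\<in>W. 2 * card (incident E v))"
  shows "\<exists>v\<in>W. \<exists>T\<subseteq>incident E v. card T = Suc m \<and> (\<forall>e\<in>T. f e \<notin> T)"
proof (rule ccontr)
  assume neg: "\<not> ?thesis"
  let ?arcs = "\<lambda>v. {e \<in> incident E v. f e \<in> incident E v}"
  have deg: "2 * card (incident E v) \<le> 3 * m + card (?arcs v)" if v: "v \<in> W" for v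
  proof -
    have "\<forall>e\<in>incident E v. f e \<noteq> e" using assms(4) by (auto simp: incident_def)
    then obtain I where I: "I \<subseteq> incident E v" "\<forall>e\<in>I. f e \<notin> I"
      "2 * card (incident E v) \<le> 3 * card I + card (?arcs v)"
      using independent_subset_Turan[of "incident E v" f] assms(1) by auto
    have "card I \<le> m"
    proof (rule ccontr)
      assume "\<not> ?thesis"
      then obtain T where T: "T \<subseteq> I" "card T = Suc m"
        by (metis obtain_subset_with_card_n not_less_eq_eq)
      then have "T \<subseteq> incident E v \<and> card T = Suc m \<and> (\<forall>e\<in>T. f e \<notin> T)" using I(1,2) by blast
      then show False using neg v by blast
    qed
    then show ?thesis using I(3) by linarith
  qed
  have "?arcs v \<inter> ?arcs w = {}" if "v \<noteq> w" for v w
  proof (rule ccontr)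
    assume "?arcs v \<inter> ?arcs w \<noteq> {}"
    then obtain e where "e \<in> E" "f e \<in> E" "{v, w} \<subseteq> e" "{v, w} \<subseteq> f e" by (auto simp: incident_def)
    then show False using edge_eqI[of "f e" e v w] assms(2,4) that by auto
  qed
  then have "(\<Sum>v\<in>W. card (?arcs v)) = card (\<Union>v\<in>W. ?arcs v)"
    using assms(1,3) by (intro card_UN_disjoint[symmetric]) auto
  also have "\<dots> \<le> card E" using assms(1) by (intro card_mono) (auto simp: incident_def)
  finally have "(\<Sum>v\<in>W. 3 * m + card (?arcs v)) \<le> 3 * m * card W + card E"
    by (simp add: sum.distrib mult.commute)
  moreover have "(\<Sum>v\<in>W. 2 * card (incident E v)) \<le> (\<Sum>v\<in>W. 3 * m + card (?arcs v))"
    by (rule sum_mono) (rule deg)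
  ultimately show False using assms(5) by linarith
qed

text \<open>Every edge of \<open>F\<close> has a leaf end, and the other end acts as a centre. Each
  vertex of \<open>F\<close> reserves a star of its own, and the edges at a centre are injected into
  the edges of its star.\<close>

lemma star_forest_embeds:
  assumes "fin_simple_graph F" "no_isolated_verts F"
    and leaf: "\<forall>e\<in>edges F. \<exists>v\<in>e. card (incident (edges F) v) \<le> 1"
    and deg: "\<forall>v. card (incident (edges F) v) \<le> k" and "k > 0"
    and "finite I" "card (verts F) \<le> card I"
    and T: "\<forall>i\<in>I. card (T i) = k \<and> (\<forall>e\<in>T i. s i \<in> e \<and> card e = 2)"
    and disj: "\<forall>i\<in>I. \<forall>j\<in>I. i \<noteq> j \<longrightarrow> \<Union> (T i) \<inter> \<Union> (T j) = {}"
  shows "\<exists>\<phi>. inj_on \<phi> (verts F) \<and> (`) \<phi> ` edges F \<subseteq> (\<Union>i\<in>I. T i)"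
proof -
  let ?E = "edges F" and ?V = "verts F"
  have finE: "finite ?E" by (rule finite_edges[OF assms(1)])
  have finV: "finite ?V" using assms(1) by (simp add: fin_simple_graph_def)
  \<comment> \<open>In a single-edge component both ends qualify; choosing one makes the other the
    centre.\<close>
  obtain lf where lf: "\<And>e. e \<in> ?E \<Longrightarrow> lf e \<in> e" "\<And>e. e \<in> ?E \<Longrightarrow> card (incident ?E (lf e)) \<le> 1"
    using leaf by metis
  have "\<exists>c. e = {lf e, c} \<and> c \<noteq> lf e" if "e \<in> ?E" for e
    using edge_other_endpoint[OF fin_simple_graph_edgeD(2)[OF assms(1) that] lf(1)[OF that]] by metis
  then obtain c where c: "\<And>e. e \<in> ?E \<Longrightarrow> e = {lf e, c e}" "\<And>e. e \<in> ?E \<Longrightarrow> c e \<noteq> lf e" by metis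
  have lf_uniq: "e' = e" if "e \<in> ?E" "e' \<in> ?E" "lf e \<in> e'" for e e'
  proof -
    have "e \<in> incident ?E (lf e)" "e' \<in> incident ?E (lf e)"
      using that lf(1) by (auto simp: incident_def)
    then show ?thesis using lf(2)[OF that(1)] finE by (auto simp: card_le_Suc0_iff_eq)
  qed
  have lf_inj: "inj_on lf ?E" using lf_uniq lf(1) by (metis inj_onI)
  have c_lf: "c e \<noteq> lf e'" if "e \<in> ?E" "e' \<in> ?E" for e e'
    using lf_uniq[OF that(2,1)] c[OF that(1)] by (metis insertI1 insert_commute)
  obtain \<pi> where \<pi>: "inj_on \<pi> ?V" "\<pi> ` ?V \<subseteq> I"
    using card_le_inj[OF finV assms(6,7)] by blast
  have cV: "c e \<in> ?V" if "e \<in> ?E" for e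
    using c(1)[OF that] fin_simple_graph_edgeD(1)[OF assms(1) that] by auto
  have ex_h: "\<exists>h. h ` {e \<in> ?E. c e = x} \<subseteq> T (\<pi> x) \<and> inj_on h {e \<in> ?E. c e = x}" if x: "x \<in> ?V" for x
  proof -
    have "{e \<in> ?E. c e = x} \<subseteq> incident ?E x" using c(1) by (auto simp: incident_def)
    then have "card {e \<in> ?E. c e = x} \<le> card (incident ?E x)" using finE by (intro card_mono) auto
    moreover have "card (T (\<pi> x)) = k" using T \<pi>(2) x by auto
    moreover from this have "finite (T (\<pi> x))" using assms(5) card_ge_0_finite by metis
    ultimately show ?thesis using card_le_inj[of "{e \<in> ?E. c e = x}" "T (\<pi> x)"] finE deg
      by (metis (no_types, lifting) finite_subset le_trans mem_Collect_eq subsetI)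
  qed
  have "\<exists>h. \<forall>x\<in>?V. h x ` {e \<in> ?E. c e = x} \<subseteq> T (\<pi> x) \<and> inj_on (h x) {e \<in> ?E. c e = x}"
    by (rule bchoice) (rule ballI, rule ex_h)
  then obtain h where h: "\<And>x. x \<in> ?V \<Longrightarrow> h x ` {e \<in> ?E. c e = x} \<subseteq> T (\<pi> x)"
    "\<And>x. x \<in> ?V \<Longrightarrow> inj_on (h x) {e \<in> ?E. c e = x}" by blast
  define t where "t e = h (c e) e" for e
  have t: "t e \<in> T (\<pi> (c e))" "\<pi> (c e) \<in> I" if "e \<in> ?E" for e
    using h(1)[OF cV[OF that]] \<pi>(2) cV[OF that] that by (auto simp: t_def)
  have "\<exists>u. t e = {s (\<pi> (c e)), u} \<and> u \<noteq> s (\<pi> (c e))" if "e \<in> ?E" for e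
    using T t[OF that] edge_other_endpoint by metis
  then obtain u where u: "\<And>e. e \<in> ?E \<Longrightarrow> t e = {s (\<pi> (c e)), u e}"
    "\<And>e. e \<in> ?E \<Longrightarrow> u e \<noteq> s (\<pi> (c e))" by metis
  have same: "i = j" if "i \<in> I" "j \<in> I" "x \<in> \<Union> (T i)" "x \<in> \<Union> (T j)" for i j x
    using disj that by blast
  have s_mem: "s i \<in> \<Union> (T i)" if "i \<in> I" for i
  proof -
    have "T i \<noteq> {}" using T that assms(5) by fastforce
    then show ?thesis using T that by blast
  qed
  have u_mem: "u e \<in> \<Union> (T (\<pi> (c e)))" if "e \<in> ?E" for e using t(1)[OF that] u(1)[OF that] by blast
  have u_inj: "e = e'" if e: "e \<in> ?E" "e' \<in> ?E" "u e = u e'" for e e'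
  proof -
    have "\<pi> (c e) = \<pi> (c e')" using same[OF t(2) t(2) u_mem, OF e(1,2,1)] u_mem[OF e(2)] e(3) by simp
    then have "c e = c e'" using \<pi>(1) cV e by (auto dest: inj_onD)
    moreover from this have "t e = t e'" using u(1) e by simp
    ultimately show ?thesis using h(2)[OF cV[OF e(1)]] e by (auto simp: t_def dest: inj_onD)
  qed
  have u_s: "u e \<noteq> s (\<pi> x)" if e: "e \<in> ?E" "x \<in> ?V" for e x
  proof
    assume eq: "u e = s (\<pi> x)"
    have "\<pi> x \<in> I" using \<pi>(2) e(2) by blast
    then have "\<pi> (c e) = \<pi> x" using same[OF t(2)[OF e(1)] _ u_mem[OF e(1)]] s_mem eq by metis
    then show False using u(2)[OF e(1)] eq by simp
  qed
  have s_inj: "x = y" if xy: "x \<in> ?V" "y \<in> ?V" "s (\<pi> x) = s (\<pi> y)" for x y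
  proof -
    have "\<pi> x \<in> I" "\<pi> y \<in> I" using \<pi>(2) xy by auto
    then have "\<pi> x = \<pi> y" using same s_mem xy(3) by metis
    then show ?thesis using \<pi>(1) xy by (auto dest: inj_onD)
  qed
  define \<phi> where "\<phi> v = (if v \<in> lf ` ?E then u (inv_into ?E lf v) else s (\<pi> v))" for v
  have \<phi>_lf: "\<phi> (lf e) = u e" if "e \<in> ?E" for e
    using that lf_inj by (simp add: \<phi>_def)
  have \<phi>_c: "\<phi> (c e) = s (\<pi> (c e))" if "e \<in> ?E" for e
    using c_lf[OF that] by (auto simp: \<phi>_def)
  have "inj_on \<phi> ?V"
  proof (rule inj_onI)
    fix x y assume xy: "x \<in> ?V" "y \<in> ?V" "\<phi> x = \<phi> y"
    consider "x \<notin> lf ` ?E" "y \<notin> lf ` ?E" | e where "e \<in> ?E" "x = lf e" "y \<notin> lf ` ?E"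
      | e where "e \<in> ?E" "y = lf e" "x \<notin> lf ` ?E" | e e' where "e \<in> ?E" "x = lf e" "e' \<in> ?E" "y = lf e'"
      by blast
    then show "x = y"
    proof cases
      case 1
      then show ?thesis using xy s_inj by (simp add: \<phi>_def)
    next
      case 2
      then show ?thesis using xy \<phi>_lf[of e] u_s[of e y] by (simp add: \<phi>_def[of y])
    next
      case 3
      then show ?thesis using xy \<phi>_lf[of e] u_s[of e x] by (simp add: \<phi>_def[of x])
    next
      case 4
      then show ?thesis using xy \<phi>_lf u_inj by metis
    qed
  qed
  moreover have "\<phi> ` e \<in> (\<Union>i\<in>I. T i)" if e: "e \<in> ?E" for e
  proof -
    have "\<phi> ` e = \<phi> ` {lf e, c e}" using c(1)[OF e] by (rule arg_cong)
    also have "\<dots> = t e" using \<phi>_lf[OF e] \<phi>_c[OF e] u(1)[OF e] by auto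
    finally show ?thesis using t[OF e] by blast
  qed
  ultimately show ?thesis by (intro exI[of _ \<phi>]) auto
qed

text \<open>The \<open>i\<close>-th caterpillar has the path \<open>cnode i 0 0, \<dots>, cnode i n 0\<close> as its spine; the ends have degree
  \<open>3 * m + 3\<close> and the inner spine vertices degree \<open>3 * m + 2\<close>, where the stars have \<open>m + 2\<close> edges. The edge \<open>cedge i j 0\<close> belongs to the
  spine, and \<open>cedge i j l\<close> with \<open>l > 0\<close> is pendant.\<close>

definition cnode :: "nat \<Rightarrow> nat \<Rightarrow> nat \<Rightarrow> nat" where
  "cnode i j l = prod_encode (i, prod_encode (j, l))"

definition cedge :: "nat \<Rightarrow> nat \<Rightarrow> nat \<Rightarrow> nat set" where
  "cedge i j l = {cnode i j 0, if l = 0 then cnode i (Suc j) 0 else cnode i j l}"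

text \<open>Index 0 is the spine edge towards \<open>j + 1\<close>; the one towards
  \<open>j - 1\<close> is listed there, so every edge has a unique index pair. The pendant numbers
  are the intended degrees minus one or two spine edges.\<close>

definition legs :: "nat \<Rightarrow> nat \<Rightarrow> nat \<Rightarrow> nat set" where
  "legs m n j = {1..if j = 0 \<or> j = n then 3 * m + 2 else 3 * m} \<union> (if j < n then {0} else {})"

definition caterpillar :: "nat \<Rightarrow> nat \<Rightarrow> nat \<Rightarrow> nat set set" where
  "caterpillar m n i = (\<lambda>(j, l). cedge i j l) ` Sigma {..n} (legs m n)"

lemma cnode_inject [simp]: "cnode i j l = cnode i' j' l' \<longleftrightarrow> i = i' \<and> j = j' \<and> l = l'"
  by (simp add: cnode_def prod_encode_eq)

lemma cedge_inject [simp]: "cedge i j l = cedge i' j' l' \<longleftrightarrow> i = i' \<and> j = j' \<and> l = l'"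
  by (auto simp: cedge_def doubleton_eq_iff)

lemma card_cedge: "card (cedge i j l) = 2"
  by (auto simp: cedge_def)

lemma caterpillarE:
  assumes "e \<in> caterpillar m n i"
  obtains j l where "e = cedge i j l" "j \<le> n" "l \<in> legs m n j"
  using assms by (auto simp: caterpillar_def)

lemma cedge_in_caterpillar_iff: "cedge i j l \<in> caterpillar m n i' \<longleftrightarrow> i = i' \<and> j \<le> n \<and> l \<in> legs m n j"
  by (force simp: caterpillar_def)

lemma finite_legs [simp]: "finite (legs m n j)"
  by (simp add: legs_def)

lemma finite_caterpillar: "finite (caterpillar m n i)"
  by (simp add: caterpillar_def)

lemma Union_caterpillar_disjoint:
  assumes "i \<noteq> i'"
  shows "\<Union> (caterpillar m n i) \<inter> \<Union> (caterpillar m n i') = {}"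
  using assms by (auto simp: caterpillar_def cedge_def split: if_splits)

lemma card_legs:
  assumes "j \<le> n" "n > 0"
  shows "card (legs m n j) = (if j = 0 then 3 * m + 3 else if j = n then 3 * m + 2 else 3 * m + 1)"
  using assms by (auto simp: legs_def)

lemma card_caterpillar:
  assumes "n > 0"
  shows "card (caterpillar m n i) = n * (3 * m + 1) + 3 * m + 4"
proof -
  obtain q where q: "n = Suc q" using assms by (cases n) auto
  have "inj_on (\<lambda>(j, l). cedge i j l) (Sigma {..n} (legs m n))" by (auto simp: inj_on_def)
  then have "card (caterpillar m n i) = card (Sigma {..n} (legs m n))"
    unfolding caterpillar_def by (rule card_image)
  also have "\<dots> = (\<Sum>j\<le>n. card (legs m n j))" by (simp add: card_SigmaI)
  also have "\<dots> = (\<Sum>j\<le>n. if j = 0 then 3 * m + 3 else if j = n then 3 * m + 2 else 3 * m + 1)"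
    using assms by (intro sum.cong) (simp_all add: card_legs)
  also have "\<dots> = (\<Sum>j\<le>q. if j = 0 then 3 * m + 3 else 3 * m + 1) + (3 * m + 2)"
    unfolding q by (auto intro!: sum.cong)
  also have "(\<Sum>j\<le>q. if j = 0 then 3 * m + 3 else 3 * m + 1) = 3 * m + 3 + q * (3 * m + 1)"
    by (simp add: sum.atMost_shift)
  finally show ?thesis by (simp add: q)
qed

lemma incident_caterpillar:
  assumes "j \<le> n"
  shows "incident (caterpillar m n i) (cnode i j 0) =
    cedge i j ` legs m n j \<union> (if j = 0 then {} else {cedge i (j - 1) 0})"
proof (intro subset_antisym subsetI)
  fix e assume e: "e \<in> incident (caterpillar m n i) (cnode i j 0)"
  then obtain j' l where jl: "e = cedge i j' l" "j' \<le> n" "l \<in> legs m n j'"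
    by (auto simp: incident_def elim: caterpillarE)
  then have "j' = j \<or> l = 0 \<and> j = Suc j'"
    using e by (auto simp: incident_def cedge_def split: if_splits)
  then show "e \<in> cedge i j ` legs m n j \<union> (if j = 0 then {} else {cedge i (j - 1) 0})"
    using jl by auto
next
  fix e assume e: "e \<in> cedge i j ` legs m n j \<union> (if j = 0 then {} else {cedge i (j - 1) 0})"
  then consider l where "l \<in> legs m n j" "e = cedge i j l" | "j > 0" "e = cedge i (j - 1) 0"
    by (auto split: if_splits)
  then show "e \<in> incident (caterpillar m n i) (cnode i j 0)"
  proof cases
    case 1
    then show ?thesis using assms by (auto simp: incident_def cedge_in_caterpillar_iff) (auto simp: cedge_def)
  next
    case 2
    then have "0 \<in> legs m n (j - 1)" using assms by (auto simp: legs_def)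
    then show ?thesis using 2 assms
      by (auto simp: incident_def cedge_in_caterpillar_iff) (auto simp: cedge_def)
  qed
qed

lemma card_incident_caterpillar:
  assumes "j \<le> n" "n > 0"
  shows "card (incident (caterpillar m n i) (cnode i j 0)) = (if j = 0 \<or> j = n then 3 * m + 3 else 3 * m + 2)"
proof -
  have "card (cedge i j ` legs m n j) = card (legs m n j)"
    by (intro card_image) (auto simp: inj_on_def)
  moreover have "cedge i (j - 1) 0 \<notin> cedge i j ` legs m n j" if "j > 0" using that by auto
  ultimately show ?thesis
    unfolding incident_caterpillar[OF assms(1)] using assms by (auto simp: card_legs)
qed

lemma caterpillar_ex_free_star:
  assumes "\<forall>e\<in>caterpillar m n i. f e \<noteq> e" "n > 0"
  shows "\<exists>s. \<exists>T\<subseteq>incident (caterpillar m n i) s. card T = Suc (Suc m) \<and> (\<forall>e\<in>T. f e \<notin> T)"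
proof -
  obtain q where q: "n = Suc q" using assms(2) by (cases n) auto
  let ?E = "caterpillar m n i" and ?W = "(\<lambda>j. cnode i j 0) ` {..n}"
  have inj: "inj_on (\<lambda>j. cnode i j 0) {..n}" by (auto simp: inj_on_def)
  have "(\<Sum>v\<in>?W. 2 * card (incident ?E v)) = (\<Sum>j\<le>n. 2 * card (incident ?E (cnode i j 0)))"
    by (simp add: sum.reindex[OF inj])
  also have "\<dots> = (\<Sum>j\<le>n. if j = 0 \<or> j = n then 6 * m + 6 else 6 * m + 4)"
    using assms(2) by (intro sum.cong) (simp_all add: card_incident_caterpillar)
  also have "\<dots> = (\<Sum>j\<le>q. if j = 0 then 6 * m + 6 else 6 * m + 4) + (6 * m + 6)"
    unfolding q by (auto intro!: sum.cong)
  also have "(\<Sum>j\<le>q. if j = 0 then 6 * m + 6 else 6 * m + 4) = 6 * m + 6 + q * (6 * m + 4)"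
    by (simp add: sum.atMost_shift)
  finally have "(\<Sum>v\<in>?W. 2 * card (incident ?E v)) = 12 * m + 12 + q * (6 * m + 4)" by simp
  moreover have "card ?W = n + 1" by (simp add: card_image[OF inj])
  \<comment> \<open>The sides are \<open>6 * m * n + 6 * m + 4 * n + 7\<close> and
    \<open>6 * m * n + 6 * m + 4 * n + 8\<close>: the count succeeds by exactly one.\<close>
  ultimately have "3 * Suc m * card ?W + card ?E < (\<Sum>v\<in>?W. 2 * card (incident ?E v))"
    using assms(2) by (simp add: card_caterpillar q algebra_simps)
  moreover have "\<forall>e\<in>?E. card e = 2" by (auto elim!: caterpillarE simp: card_cedge)
  ultimately show ?thesis
    using ex_free_star[of ?E ?W f "Suc m"] finite_caterpillar assms(1) by blast
qed

section \<open>Disjoint unions of caterpillars\<close>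

definition caterpillars :: "nat \<Rightarrow> nat \<Rightarrow> nat \<Rightarrow> nat graph" where
  "caterpillars m n R = (\<Union> (\<Union>i<R. caterpillar m n i), \<Union>i<R. caterpillar m n i)"

lemma fin_simple_graph_caterpillars: "fin_simple_graph (caterpillars m n R)"
proof -
  have "card e = 2" if "e \<in> caterpillar m n i" for e i
    using that by (auto elim!: caterpillarE simp: card_cedge)
  then show ?thesis
    by (auto simp: caterpillars_def fin_simple_graph_def finite_caterpillar intro!: finite_Union
        intro: card_ge_0_finite)
qed

text \<open>The free star of a caterpillar has \<open>m + 2\<close> edges, which \<open>f\<close>
  sends into at most \<open>m + 2\<close> caterpillars. The number of copies lets
  \<open>independent_subset\<close> select \<open>card (verts F)\<close> stars with no arcs between
  different ones.\<close>

lemma unavoidable_caterpillars: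
  assumes "fin_simple_graph F" "no_isolated_verts F" "n > 0"
    and leaf: "\<forall>e\<in>edges F. \<exists>v\<in>e. card (incident (edges F) v) \<le> 1"
    and deg: "\<forall>v. card (incident (edges F) v) \<le> Suc (Suc m)"
  shows "unavoidable F (caterpillars m n (card (verts F) * (2 * Suc (Suc m) + 1)))"
    (is "unavoidable F (caterpillars m n ?R)")
proof (rule unavoidableI)
  fix f assume f: "\<forall>e\<in>edges (caterpillars m n ?R). f e \<noteq> e"
  let ?C = "caterpillar m n"
  have "\<forall>i\<in>{..<?R}. \<exists>p. snd p \<subseteq> incident (?C i) (fst p) \<and> card (snd p) = Suc (Suc m) \<and>
      (\<forall>e\<in>snd p. f e \<notin> snd p)" (is "\<forall>i\<in>_. ?P i")
  proof
    fix i assume "i \<in> {..<?R}"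
    then have "\<forall>e\<in>?C i. f e \<noteq> e" using f by (auto simp: caterpillars_def)
    from caterpillar_ex_free_star[OF this assms(3)]
    show "?P i" by fastforce
  qed
  from bchoice[OF this] obtain st where st: "\<And>i. i < ?R \<Longrightarrow> snd (st i) \<subseteq> incident (?C i) (fst (st i)) \<and>
      card (snd (st i)) = Suc (Suc m) \<and> (\<forall>e\<in>snd (st i). f e \<notin> snd (st i))"
    by auto
  define s where "s i = fst (st i)" for i
  define T where "T i = snd (st i)" for i
  have T: "T i \<subseteq> incident (?C i) (s i)" "card (T i) = Suc (Suc m)" "\<And>e. e \<in> T i \<Longrightarrow> f e \<notin> T i"
    if "i < ?R" for i using st[OF that] by (auto simp: T_def s_def)
  have T_sub: "T i \<subseteq> ?C i" if "i < ?R" for i using T(1)[OF that] by (auto simp: incident_def)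
  have finT: "finite (T i)" if "i < ?R" for i
    using T_sub[OF that] finite_caterpillar finite_subset by blast
  have cat_uniq: "i = j" if "e \<in> ?C i" "e \<in> ?C j" for e i j
    using that by (auto elim!: caterpillarE)
  define N where "N i = {j. \<exists>e\<in>T i. f e \<in> ?C j}" for i
  have N: "card (N i \<inter> {..<?R}) \<le> Suc (Suc m)" if i: "i \<in> {..<?R}" for i
  proof -
    have "N i \<inter> {..<?R} = (\<Union>e\<in>T i. {j. j < ?R \<and> f e \<in> ?C j})" by (auto simp: N_def)
    then have "card (N i \<inter> {..<?R}) \<le> (\<Sum>e\<in>T i. card {j. j < ?R \<and> f e \<in> ?C j})"
      using card_UN_le[of "T i"] finT i by simp
    also have "\<dots> \<le> (\<Sum>e\<in>T i. 1)"
      using cat_uniq by (intro sum_mono) (auto simp: card_le_Suc0_iff_eq)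
    finally show ?thesis using T(2) i by simp
  qed
  obtain I where I: "I \<subseteq> {..<?R}" "card I = card (verts F)" "\<forall>i\<in>I. \<forall>j\<in>I. j \<in> N i \<longrightarrow> j = i"
    using independent_subset[of "{..<?R}" N "Suc (Suc m)" "card (verts F)", OF _ N] by auto
  have lt: "i < ?R" if "i \<in> I" for i using I(1) that by auto
  have "s i \<in> e \<and> card e = 2" if "i \<in> I" "e \<in> T i" for i e
    using subsetD[OF T(1)[OF lt[OF that(1)]] that(2)]
    by (auto simp: incident_def card_cedge elim!: caterpillarE)
  then have "\<forall>i\<in>I. card (T i) = Suc (Suc m) \<and> (\<forall>e\<in>T i. s i \<in> e \<and> card e = 2)"
    using T(2) lt by simp
  moreover have "\<forall>i\<in>I. \<forall>j\<in>I. i \<noteq> j \<longrightarrow> \<Union> (T i) \<inter> \<Union> (T j) = {}"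
  proof (intro ballI impI)
    fix i j assume ij: "i \<in> I" "j \<in> I" "i \<noteq> j"
    show "\<Union> (T i) \<inter> \<Union> (T j) = {}"
      using Union_caterpillar_disjoint[OF ij(3), of m n] Union_mono[OF T_sub[OF lt[OF ij(1)]]]
        Union_mono[OF T_sub[OF lt[OF ij(2)]]] by blast
  qed
  ultimately obtain \<phi> where \<phi>: "inj_on \<phi> (verts F)" "(`) \<phi> ` edges F \<subseteq> (\<Union>i\<in>I. T i)"
    using star_forest_embeds[OF assms(1,2) leaf deg, of I T s] finite_subset[OF I(1)] I(2) by auto
  have "f (\<phi> ` e) \<notin> (`) \<phi> ` edges F" if e: "e \<in> edges F" for e
  proof
    assume "f (\<phi> ` e) \<in> (`) \<phi> ` edges F"
    then have "f (\<phi> ` e) \<in> (\<Union>i\<in>I. T i)" by (rule subsetD[OF \<phi>(2)])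
    moreover have "\<phi> ` e \<in> (\<Union>i\<in>I. T i)" using subsetD[OF \<phi>(2)] e by blast
    ultimately obtain i j where ij: "i \<in> I" "\<phi> ` e \<in> T i" "j \<in> I" "f (\<phi> ` e) \<in> T j" by blast
    then have "j \<in> N i" using subsetD[OF T_sub[OF lt[OF ij(3)]]] by (auto simp: N_def)
    then have "j = i" using I(3) ij(1,3) by simp
    then show False using T(3)[OF lt[OF ij(1)] ij(2)] ij(4) by simp
  qed
  moreover have "(`) \<phi> ` edges F \<subseteq> edges (caterpillars m n ?R)"
  proof -
    have "(\<Union>i\<in>I. T i) \<subseteq> (\<Union>i<?R. ?C i)" using T_sub I(1) by blast
    then show ?thesis using \<phi>(2) by (simp add: caterpillars_def)
  qed
  ultimately show "\<exists>\<phi>. inj_on \<phi> (verts F) \<and> (`) \<phi> ` edges F \<subseteq> edges (caterpillars m n ?R) \<and>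
    (\<forall>e\<in>edges F. f (\<phi> ` e) \<notin> (`) \<phi> ` edges F)" using \<phi>(1) by blast
qed (use assms fin_simple_graph_caterpillars in auto)

text \<open>If some spine edge \<open>cedge i (q i) 0\<close> is missing in each caterpillar, the spine edges can be oriented
  such that the ends own all their edges and every other vertex all but at most one.\<close>

lemma caterpillars_not_unavoidable:
  assumes F: "fin_simple_graph F" and deg: "Suc (Suc m) \<le> card (incident (edges F) y)"
    and H: "subgraph H (caterpillars m n R)" and n: "n > 0"
    and q: "\<And>i. i < R \<Longrightarrow> q i < n \<and> cedge i (q i) 0 \<notin> edges H"
  shows "\<not> unavoidable F H"
proof -
  have fH: "fin_simple_graph H" using H by (simp add: subgraph_def)
  have finH: "finite (edges H)" by (rule finite_edges[OF fH])
  define enc where "enc = (\<lambda>(i, j, l). cedge i j l)"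
  have enc: "inj enc" by (auto simp: inj_def enc_def)
  \<comment> \<open>A spine edge is owned by its end farther from the gap \<open>q i\<close>, a
    pendant edge by its spine vertex. An inner spine vertex thus fails to own at most the spine edge
    leading away from the gap.\<close>
  define own where "own e = (case inv enc e of (i, j, l) \<Rightarrow>
    if l = 0 \<and> q i < j then cnode i (Suc j) 0 else cnode i j 0)" for e
  have own: "own (cedge i j l) = (if l = 0 \<and> q i < j then cnode i (Suc j) 0 else cnode i j 0)" for i j l
    using inv_f_f[OF enc, of "(i, j, l)"] by (simp add: own_def enc_def)
  have memH: "\<exists>i j l. e = cedge i j l \<and> i < R \<and> j \<le> n \<and> l \<in> legs m n j" if "e \<in> edges H" for e
    using that H by (fastforce simp: subgraph_def caterpillars_def elim: caterpillarE)
  define A where "A x = {e \<in> incident (edges H) x. own e = x}" for x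
  \<comment> \<open>The budget of \<open>no_large_independent_set\<close>: at most
    \<open>3 * m + 3 + 0\<close> at a spine end, \<open>3 * m + 2 + 1\<close> at an inner spine
    vertex and \<open>1 + 1\<close> elsewhere.\<close>
  have local: "card (incident (edges H) x - A x) \<le> 1 \<and>
    card (incident (edges H) x) + card (incident (edges H) x - A x) \<le> 3 * Suc m" for x
  proof (cases "\<exists>i j. x = cnode i j 0 \<and> i < R \<and> j \<le> n")
    case True
    then obtain i j where x: "x = cnode i j 0" "i < R" "j \<le> n" by blast
    let ?X = "incident (edges H) x"
    have sub: "?X \<subseteq> incident (caterpillar m n i) x"
    proof
      fix e assume e: "e \<in> ?X"
      then obtain i' j' l where e': "e = cedge i' j' l" "j' \<le> n" "l \<in> legs m n j'"
        using memH[of e] by (auto simp: incident_def)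
      then have "i' = i" using e x by (auto simp: incident_def cedge_def split: if_splits)
      then show "e \<in> incident (caterpillar m n i) x"
        using e e' by (auto simp: incident_def cedge_in_caterpillar_iff)
    qed
    have fin: "finite (incident (caterpillar m n i) x)" using finite_caterpillar by simp
    have cX: "card ?X \<le> (if j = 0 \<or> j = n then 3 * m + 3 else 3 * m + 2)"
      using card_mono[OF fin sub] card_incident_caterpillar[OF x(3) n] x(1) by simp
    have nonown: "e = (if q i < j then cedge i j 0 else cedge i (j - 1) 0) \<and> 0 < j \<and> j < n"
      if e: "e \<in> ?X - A x" for e
    proof -
      have "e \<in> cedge i j ` legs m n j \<union> (if j = 0 then {} else {cedge i (j - 1) 0})"
        using sub e incident_caterpillar[OF x(3)] x(1) by blast
      then consider l where "l \<in> legs m n j" "e = cedge i j l" | "j > 0" "e = cedge i (j - 1) 0"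
        by (auto split: if_splits)
      then show ?thesis
      proof cases
        case 1
        then have "l = 0" "q i < j" using e by (auto simp: A_def own x split: if_splits)
        then show ?thesis using 1 by (auto simp: legs_def split: if_splits)
      next
        case 2
        then have "\<not> q i < j - 1" using e by (auto simp: A_def own x split: if_splits)
        moreover have "q i \<noteq> j - 1" using q[OF x(2)] e 2 by (auto simp: incident_def)
        ultimately show ?thesis using 2 q[OF x(2)] by auto
      qed
    qed
    show ?thesis
    proof (cases "j = 0 \<or> j = n")
      case True
      then have "?X - A x = {}" using nonown by blast
      then have "card (?X - A x) = 0" by (metis card.empty)
      then show ?thesis using cX True by simp
    next
      case False
      have "?X - A x \<subseteq> {if q i < j then cedge i j 0 else cedge i (j - 1) 0}" using nonown by blast
      from card_mono[OF _ this] have "card (?X - A x) \<le> 1" by simp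
      then show ?thesis using cX False by simp
    qed
  next
    case False
    have uniq: "e = cedge i j l" if ex: "e \<in> incident (edges H) x" "x = cnode i j l" for e i j l
    proof -
      obtain i' j' l' where e: "e = cedge i' j' l'" "i' < R" "j' \<le> n" "l' \<in> legs m n j'"
        using memH[of e] ex(1) by (auto simp: incident_def)
      then have "l' = 0 \<Longrightarrow> Suc j' \<le> n" by (auto simp: legs_def split: if_splits)
      then show ?thesis using e ex False by (auto simp: incident_def cedge_def split: if_splits)
    qed
    obtain i j l where "x = cnode i j l" unfolding cnode_def by (metis prod_encode_inverse surj_pair prod_decode_inverse)
    then have "incident (edges H) x \<subseteq> {cedge i j l}" using uniq by blast
    from card_mono[OF _ this] have "card (incident (edges H) x) \<le> 1" by simp
    moreover have "card (incident (edges H) x - A x) \<le> card (incident (edges H) x)"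
      using finH by (intro card_mono) auto
    ultimately show ?thesis by simp
  qed
  have "\<forall>x. \<exists>h. \<forall>I\<subseteq>incident (edges H) x. (\<forall>e\<in>I \<inter> A x. h e \<in> I \<longrightarrow> h e = e) \<longrightarrow> card I \<le> Suc m"
  proof
    fix x
    show "\<exists>h. \<forall>I\<subseteq>incident (edges H) x. (\<forall>e\<in>I \<inter> A x. h e \<in> I \<longrightarrow> h e = e) \<longrightarrow> card I \<le> Suc m"
      by (rule no_large_independent_set) (use local[of x] finH in \<open>auto simp: A_def\<close>)
  qed
  from choice[OF this] obtain h where h: "\<And>x I. I \<subseteq> incident (edges H) x \<Longrightarrow>
      \<forall>e\<in>I \<inter> A x. h x e \<in> I \<longrightarrow> h x e = e \<Longrightarrow> card I \<le> Suc m" by blast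
  show ?thesis
  \<comment> \<open>Each edge follows the rule of its owner only, so the maps \<open>h x\<close> of
    different vertices never compete for it. The image of the star at \<open>y\<close> has one edge
    more than an independent set can have.\<close>
  proof (rule not_unavoidableI[where g = "\<lambda>e. h (own e) e"])
    have "card (incident (edges F) y) \<le> card (edges F)"
      using finite_edges[OF F] by (intro card_mono) (auto simp: incident_def)
    then show "2 \<le> card (edges F)" using deg by simp
  next
    fix G' assume copy: "copy_in F H G'"
    obtain \<phi> where \<phi>: "inj_on \<phi> (verts F)" "edges G' = (`) \<phi> ` edges F" "edges G' \<subseteq> edges H"
      using copy by (elim copy_inE) (auto simp: subgraph_def)
    define I where "I = (`) \<phi> ` incident (edges F) y"
    have I: "I \<subseteq> edges G'" "I \<subseteq> incident (edges H) (\<phi> y)"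
      using \<phi>(2,3) by (auto simp: I_def incident_def)
    have "inj_on ((`) \<phi>) (incident (edges F) y)"
      using inj_on_image_edges[OF F \<phi>(1)] by (rule inj_on_subset) (auto simp: incident_def)
    then have "Suc (Suc m) \<le> card I" using deg by (simp add: I_def card_image)
    then obtain e where e: "e \<in> I \<inter> A (\<phi> y)" "h (\<phi> y) e \<in> I" "h (\<phi> y) e \<noteq> e"
      using h[OF I(2)] by fastforce
    then have "own e = \<phi> y" by (simp add: A_def)
    then show "\<exists>e\<in>edges G'. h (own e) e \<in> edges G' \<and> h (own e) e \<noteq> e" 
      using e I(1) by (intro bexI[of _ e]) auto
  qed
qed

text \<open>A subgraph with fewer than \<open>n\<close> edges misses an edge of every spine of
  \<open>n + 1\<close> edges, and is then avoidable.\<close>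

lemma infinite_min_unavoidables_stars:
  assumes F: "fin_simple_graph F" "no_isolated_verts F"
    and leaf: "\<forall>e\<in>edges F. \<exists>v\<in>e. card (incident (edges F) v) \<le> 1"
    and deg: "\<forall>v. card (incident (edges F) v) \<le> Suc (Suc m)"
    and y: "card (incident (edges F) y) = Suc (Suc m)"
  shows "infinite (min_unavoidables F)"
proof (rule infinite_min_unavoidables)
  fix n :: nat
  define R where "R = card (verts F) * (2 * Suc (Suc m) + 1)"
  let ?G = "caterpillars m (Suc n) R"
  have "n \<le> card (edges H)" if sub: "subgraph H ?G" and un: "unavoidable F H" for H
  proof (rule ccontr)
    assume small: "\<not> ?thesis"
    have finH: "finite (edges H)" using sub finite_edges[of H] by (simp add: subgraph_def)
    have "\<exists>j<Suc n. cedge i j 0 \<notin> edges H" for i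
    proof (rule ccontr)
      assume "\<not> ?thesis"
      then have "(\<lambda>j. cedge i j 0) ` {..<Suc n} \<subseteq> edges H" by auto
      then have "card {..<Suc n} \<le> card (edges H)"
        using finH by (intro card_inj_on_le[of "\<lambda>j. cedge i j 0"]) (auto simp: inj_on_def)
      then show False using small by simp
    qed
    then obtain q where "\<And>i. q i < Suc n \<and> cedge i (q i) 0 \<notin> edges H" by metis
    then have "\<not> unavoidable F H"
      using caterpillars_not_unavoidable[OF F(1) _ sub, of y q] y by simp
    then show False using un by blast
  qed
  moreover have "unavoidable F ?G"
    unfolding R_def by (rule unavoidable_caterpillars[OF F _ leaf deg]) simp
  ultimately show "\<exists>G :: nat graph. unavoidable F G \<and>
    (\<forall>G'. subgraph G' G \<and> unavoidable F G' \<longrightarrow> n \<le> card (edges G'))" by blast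
qed

theorem theorem1p3:
  fixes F :: "'a graph"
  assumes "forest F" and "no_isolated_verts F"
  shows "finite (min_unavoidables F) \<longleftrightarrow> (\<exists>t. graph_iso F (tK2 t))"
proof
  assume "\<exists>t. graph_iso F (tK2 t)"
  then show "finite (min_unavoidables F)" using finite_min_unavoidables_matching by blast
next
  assume fin: "finite (min_unavoidables F)"
  let ?d = "\<lambda>v. card (incident (edges F) v)"
  have fF: "fin_simple_graph F" using assms(1) by (simp add: forest_def)
  have finE: "finite (edges F)" by (rule finite_edges[OF fF])
  have leaf: "\<exists>v\<in>e. ?d v \<le> 1" if e: "e \<in> edges F" for e
  proof (rule ccontr)
    assume neg: "\<not> ?thesis"
    obtain b c where bc: "e = {b, c}" using fin_simple_graph_edgeD(2)[OF fF e] by (auto simp: card_2_iff)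
    then have "2 \<le> ?d b" "2 \<le> ?d c" using neg by auto
    then show False using infinite_min_unavoidables_non_star[OF assms] e bc fin by blast
  qed
  have le1: "?d v \<le> 1" for v
  proof (rule ccontr)
    assume neg: "\<not> ?thesis"
    have bound: "?d w \<le> card (edges F)" for w
      using finE by (intro card_mono) (auto simp: incident_def)
    \<comment> \<open>The degree at \<open>y\<close> serves twice: as the star size that suffices to
      host all of \<open>F\<close>, and as the size of the star that small subgraphs fail to
      provide.\<close>
    then obtain y where y: "\<And>w. ?d w \<le> ?d y"
      using ex_has_greatest_nat[of "\<lambda>_. True" v ?d "Suc (card (edges F))"] by (auto simp: le_imp_less_Suc)
    have "2 \<le> ?d y" using y[of v] neg by simp
    then obtain m where m: "?d y = Suc (Suc m)" by (metis Suc_le_D numeral_2_eq_2 Suc_le_mono)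
    show False
      using infinite_min_unavoidables_stars[OF fF assms(2), of m y] leaf y m fin by auto
  qed
  have "disjoint (edges F)"
  proof (rule disjointI, rule ccontr)
    fix e e' assume e: "e \<in> edges F" "e' \<in> edges F" "e \<noteq> e'" "e \<inter> e' \<noteq> {}"
    then obtain v where "e \<in> incident (edges F) v" "e' \<in> incident (edges F) v"
      by (auto simp: incident_def)
    then show False using le1[of v] finE e(3) by (auto simp: card_le_Suc0_iff_eq)
  qed
  moreover have "verts F = \<Union> (edges F)"
    using assms(2) fin_simple_graph_edgeD(1)[OF fF] unfolding no_isolated_verts_def by blast
  ultimately show "\<exists>t. graph_iso F (tK2 t)"
    using graph_iso_sym[OF graph_iso_tK2I[OF fF]] by blast
qed

end
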